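(* Let $F(z)\in\mathbb{Z}[[z]]$ be the power series with $F(0)=1$ satisfying $F(z)=(1+z+z^2)F(z^4)-z^4F(z^{16})$. Then the functions $F(z)$, $F(z^4)$, $F'(z)$, and $F'(z^4)$ are algebraically independent over $\mathbb{C}(z)$.
   Context: The functional equation $F(z)=(1+z+z^2)F(z^4)-z^4F(z^{16})$ together with $F(0)=1$ determines the power series $F(z)=1+z+z^2+z^5+z^6+z^8+z^9+z^{10}+\cdots$ uniquely; it converges in the open unit disc. *)

theory Defs
  imports
    "HOL-Analysis.Analysis"
    "HOL-Computational_Algebra.Computational_Algebra"
    "HOL-Library.Poly_Mapping"
begin

(* A multivariate polynomial is a finitely supported map from monomials to coefficients,
   where a monomial is a finitely supported map from variable indices to exponents. *)
type_synonym 'a multipoly = "(nat \<Rightarrow>\<^sub>0 nat) \<Rightarrow>\<^sub>0 'a"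

definition multipoly_eval :: "'a::comm_semiring_1 multipoly \<Rightarrow> (nat \<Rightarrow> 'a) \<Rightarrow> 'a" where
  "multipoly_eval P x =
     (\<Sum>m\<in>Poly_Mapping.keys P. Poly_Mapping.lookup P m *
        (\<Prod>i\<in>Poly_Mapping.keys m. x i ^ Poly_Mapping.lookup m i))"

definition multipolys_over :: "'a::zero set \<Rightarrow> nat \<Rightarrow> 'a multipoly set" where
  "multipolys_over K n =
     {P. \<forall>m\<in>Poly_Mapping.keys P. Poly_Mapping.lookup P m \<in> K \<and> Poly_Mapping.keys m \<subseteq> {..<n}}"

(* Intended for K a subfield. The elements form a list, so a repeated entry counts as dependent. *)
definition algebraically_independent_over :: "'a::field set \<Rightarrow> 'a list \<Rightarrow> bool" where
  "algebraically_independent_over K xs \<longleftrightarrow>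
     (\<forall>P\<in>multipolys_over K (length xs). multipoly_eval P (\<lambda>i. xs ! i) = 0 \<longrightarrow> P = 0)"

(* The field C(z), embedded in the field C((z)) of formal Laurent series by expansion at 0. *)
definition complex_rational_functions :: "complex fls set" where
  "complex_rational_functions =
     {fps_to_fls (fps_of_poly p) / fps_to_fls (fps_of_poly q) | p q. q \<noteq> 0}"

definition complex_fps_of_int_fps :: "int fps \<Rightarrow> complex fps" where
  "complex_fps_of_int_fps F = Abs_fps (\<lambda>n. of_int (fps_nth F n))"

end

theory Submission
  imports Defs "HOL-Computational_Algebra.Field_as_Ring"
begin

text \<open>
  Let \<open>\<sigma>\<close> be the substitution \<open>z \<mapsto> z\<^sup>4\<close> on Laurent series, \<open>p = 1 + z + z\<^sup>2\<close>, \<open>a = F(z)\<close>,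
  \<open>u = a / \<sigma> a\<close>, \<open>w = u'\<close> and \<open>l = a' / a\<close>. The four functions of the theorem generate the same field
  over \<open>\<complex>(z)\<close> as \<open>u\<close>, \<open>w\<close>, \<open>l\<close>, \<open>a\<close>, which satisfy
  \<open>u = p - z\<^sup>4 / \<sigma> u\<close>,
  \<open>w = (4/z) (p - u)\<^sup>2 \<sigma> w + p' - (4/z) (p - u)\<close>,
  \<open>l = 4 z\<^sup>3 \<sigma> l + w / u\<close> and \<open>a = u \<sigma> a\<close>.
  Each of them is transcendental over the field generated by the previous ones. Comparing a minimal
  polynomial with its image under \<open>\<sigma>\<close> shows that otherwise the corresponding equation (for \<open>a\<close>, a
  power of it) would have a solution in that smaller field. For \<open>u\<close> this would be an algebraic curve
  invariant under the Riccati equation; it is excluded by its growth at \<open>z = \<infinity>\<close>. As there are no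
  invariant curves, the coefficients (with respect to \<open>w\<close> and \<open>l\<close>) of a solution of one of the other
  equations have no poles in \<open>u\<close>, and the equation bounds their degree in \<open>u\<close>. The bound is negative
  except for the equation of \<open>w\<close>, where a quadratic polynomial in \<open>u\<close> remains; its coefficients in
  \<open>\<complex>(z)\<close> are excluded by expanding them at \<open>z = \<infinity>\<close>.
\<close>

section \<open>Subfields and transcendental elements\<close>

text \<open>Subfields are subsets of one ambient field, so that the whole tower of extensions lives
  in a single type.\<close>

locale subfield_of =
  fixes K :: "'a::field set"
  assumes one_closed [simp, intro]: "1 \<in> K"
    and diff_closed [simp, intro]: "x \<in> K \<Longrightarrow> y \<in> K \<Longrightarrow> x - y \<in> K"
    and mult_closed [simp, intro]: "x \<in> K \<Longrightarrow> y \<in> K \<Longrightarrow> x * y \<in> K"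
    and inverse_closed [simp, intro]: "x \<in> K \<Longrightarrow> inverse x \<in> K"
begin

lemma zero_closed [simp, intro]: "0 \<in> K"
  using diff_closed[OF one_closed one_closed] by simp

lemma uminus_closed [simp, intro]: "x \<in> K \<Longrightarrow> - x \<in> K"
  using diff_closed[OF zero_closed] by force

lemma add_closed [simp, intro]: "x \<in> K \<Longrightarrow> y \<in> K \<Longrightarrow> x + y \<in> K"
  using diff_closed[OF _ uminus_closed] by force

lemma divide_closed [simp, intro]: "x \<in> K \<Longrightarrow> y \<in> K \<Longrightarrow> x / y \<in> K"
  by (simp add: divide_inverse)

lemma power_closed [simp, intro]: "x \<in> K \<Longrightarrow> x ^ n \<in> K"
  by (induction n) auto

lemma sum_closed [intro]: "(\<And>i. i \<in> A \<Longrightarrow> f i \<in> K) \<Longrightarrow> sum f A \<in> K"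
  by (induction A rule: infinite_finite_induct) auto

lemma of_nat_closed [simp, intro]: "of_nat n \<in> K"
  by (induction n) auto

lemma numeral_closed [simp, intro]: "numeral n \<in> K"
  using of_nat_closed[of "numeral n"] by simp

end

definition polys_over :: "'a::zero set \<Rightarrow> 'a poly set" where
  "polys_over K = {f. \<forall>i. coeff f i \<in> K}"

definition adjoin :: "'a::field set \<Rightarrow> 'a \<Rightarrow> 'a set" where
  "adjoin K x =
     {poly f x / poly g x | f g. f \<in> polys_over K \<and> g \<in> polys_over K \<and> poly g x \<noteq> 0}"

lemma adjoinI:
  "f \<in> polys_over K \<Longrightarrow> g \<in> polys_over K \<Longrightarrow> poly g x \<noteq> 0 \<Longrightarrow> r = poly f x / poly g x \<Longrightarrow> r \<in> adjoin K x"
  unfolding adjoin_def by blast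

definition transcendental_over :: "'a::field set \<Rightarrow> 'a \<Rightarrow> bool" where
  "transcendental_over K x \<longleftrightarrow> (\<forall>f\<in>polys_over K. poly f x = 0 \<longrightarrow> f = 0)"

text \<open>Coprimality in Bezout form: it yields cancellation in divisibilities and can be carried
  through a substitution by transforming the identity itself. For polynomials over a subfield the
  cofactors may lie over the ambient field.\<close>

definition comaximal :: "'a::comm_ring_1 \<Rightarrow> 'a \<Rightarrow> bool" where
  "comaximal a b \<longleftrightarrow> (\<exists>x y. x * a + y * b = 1)"

lemma comaximal_sym: "comaximal a b \<Longrightarrow> comaximal b a"
  unfolding comaximal_def by (metis add.commute)

lemma comaximal_dvd_mult:
  assumes "comaximal a b" "a dvd b * c"
  shows "a dvd c"
proof -
  obtain x y where "x * a + y * b = 1"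
    using assms(1) unfolding comaximal_def by blast
  hence "c = (x * a + y * b) * c"
    by simp
  also have "\<dots> = a * (x * c) + y * (b * c)"
    by (simp add: algebra_simps)
  finally have "c = a * (x * c) + y * (b * c)" .
  thus ?thesis
    using assms(2) by (metis dvd_add dvd_mult dvd_triv_left)
qed

lemma comaximal_mult:
  assumes "comaximal a b" "comaximal a c"
  shows "comaximal a (b * c)"
proof -
  obtain x y where 1: "x * a + y * b = 1"
    using assms(1) unfolding comaximal_def by blast
  obtain x' y' where 2: "x' * a + y' * c = 1"
    using assms(2) unfolding comaximal_def by blast
  have "(x * x' * a + x * y' * c + y * b * x') * a + (y * y') * (b * c)
      = (x * a + y * b) * (x' * a + y' * c)"
    by (simp add: algebra_simps)
  thus ?thesis
    unfolding comaximal_def by (metis 1 2 mult_1)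
qed

lemma comaximal_power: "comaximal a b \<Longrightarrow> comaximal a (b ^ n)"
proof (induction n)
  case 0
  have "0 * a + 1 * b ^ 0 = 1"
    by simp
  thus ?case
    unfolding comaximal_def by blast
qed (simp add: comaximal_mult)

text \<open>Division by the linear factor leaves the constant \<open>poly f c\<close>, a unit. The
  shape \<open>[:c, -1:]\<close> is that of the factor \<open>p - X\<close> occurring in the Moebius
  substitution.\<close>

lemma comaximal_linear:
  fixes f :: "'a::field poly"
  assumes "poly f c \<noteq> 0"
  shows "comaximal f [:c, -1:]"
proof -
  have "f = [:-c, 1:] * synthetic_div f c + [:poly f c:]"
    using synthetic_div_correct'[of c f] by simp
  hence "f + synthetic_div f c * [:c, -1:] = [:poly f c:]"
    by (metis (no_types, lifting) add.commute add_diff_cancel_left' add_minus_cancel minus_pCons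
        minus_minus minus_mult_right minus_zero mult.commute diff_conv_add_uminus)
  hence "smult (1 / poly f c) (f + synthetic_div f c * [:c, -1:]) = 1"
    using assms by (simp only: smult_pCons) (simp add: one_pCons)
  hence "[:1 / poly f c:] * f + smult (1 / poly f c) (synthetic_div f c) * [:c, -1:] = 1"
    by (simp only: smult_add_right mult_smult_left) simp
  thus ?thesis
    unfolding comaximal_def by blast
qed

section \<open>Polynomials over a subfield: lowest terms, transcendence, minimal polynomials\<close>

context subfield_of
begin

lemma polys_over_0 [simp, intro]: "0 \<in> polys_over K"
  and polys_over_1 [simp, intro]: "1 \<in> polys_over K"
  and polys_over_add [simp, intro]: "f \<in> polys_over K \<Longrightarrow> g \<in> polys_over K \<Longrightarrow> f + g \<in> polys_over K"
  and polys_over_diff [simp, intro]: "f \<in> polys_over K \<Longrightarrow> g \<in> polys_over K \<Longrightarrow> f - g \<in> polys_over K"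
  and polys_over_smult [simp, intro]: "c \<in> K \<Longrightarrow> f \<in> polys_over K \<Longrightarrow> smult c f \<in> polys_over K"
  and polys_over_monom [simp, intro]: "c \<in> K \<Longrightarrow> monom c n \<in> polys_over K"
  by (auto simp: polys_over_def)

lemma polys_over_pCons [simp, intro]: "c \<in> K \<Longrightarrow> f \<in> polys_over K \<Longrightarrow> pCons c f \<in> polys_over K"
  by (auto simp: polys_over_def coeff_pCons split: nat.split)

lemma polys_over_mult [simp, intro]: "f \<in> polys_over K \<Longrightarrow> g \<in> polys_over K \<Longrightarrow> f * g \<in> polys_over K"
  by (auto simp: polys_over_def coeff_mult)

lemma polys_over_power [simp, intro]: "f \<in> polys_over K \<Longrightarrow> f ^ n \<in> polys_over K"
  by (induction n) auto

lemma polys_over_sum [intro]: "(\<And>i. i \<in> A \<Longrightarrow> f i \<in> polys_over K) \<Longrightarrow> sum f A \<in> polys_over K"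
  by (induction A rule: infinite_finite_induct) auto

lemma polys_over_pCons_iff: "pCons c f \<in> polys_over K \<longleftrightarrow> c \<in> K \<and> f \<in> polys_over K"
proof
  assume "pCons c f \<in> polys_over K"
  hence *: "coeff (pCons c f) i \<in> K" for i
    by (auto simp: polys_over_def)
  show "c \<in> K \<and> f \<in> polys_over K"
    using *[of 0] *[of "Suc _"] by (auto simp: polys_over_def)
qed auto

lemma polys_over_pcompose [intro]:
  "f \<in> polys_over K \<Longrightarrow> g \<in> polys_over K \<Longrightarrow> pcompose f g \<in> polys_over K"
proof (induction f)
  case (pCons c f)
  thus ?case
    by (auto simp: pcompose_pCons polys_over_pCons_iff)
qed auto

lemma poly_closed [intro]: "f \<in> polys_over K \<Longrightarrow> x \<in> K \<Longrightarrow> poly f x \<in> K"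
  by (induction f) (auto simp: polys_over_pCons_iff)

lemma polys_over_pderiv [intro]: "f \<in> polys_over K \<Longrightarrow> pderiv f \<in> polys_over K"
  by (auto simp: polys_over_def coeff_pderiv simp del: of_nat_Suc)

lemma polys_over_division:
  assumes "f \<in> polys_over K" "h \<in> polys_over K" "h \<noteq> 0"
  shows "\<exists>q\<in>polys_over K. \<exists>r\<in>polys_over K. f = q * h + r \<and> (r = 0 \<or> degree r < degree h)"
  using assms(1)
proof (induction "degree f" arbitrary: f rule: less_induct)
  case less
  show ?case
  proof (cases "f = 0 \<or> degree f < degree h")
    case True
    thus ?thesis
      using less.prems by (intro bexI[of _ 0] bexI[of _ f]) auto
  next
    case False
    define c where "c = lead_coeff f / lead_coeff h"
    define n where "n = degree f - degree h"
    have c: "c \<in> K" "c \<noteq> 0"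
      using less.prems assms False by (auto simp: c_def polys_over_def)
    define f' where "f' = f - monom c n * h"
    have f': "f' \<in> polys_over K"
      using less.prems assms c by (auto simp: f'_def)
    have deg: "degree (monom c n * h) = degree f"
      using c assms(3) False by (simp add: degree_mult_eq degree_monom_eq n_def)
    have lead: "lead_coeff (monom c n * h) = lead_coeff f"
      unfolding lead_coeff_mult using c assms(3) by (simp add: degree_monom_eq) (simp add: c_def)
    show ?thesis
    \<comment> \<open>Constants are separate: since \<open>degree 0 = 0\<close>, the degree cannot
      drop when \<open>f'\<close> vanishes.\<close>
    proof (cases "degree f = 0")
      case True
      hence "degree h = 0"
        using False by auto
      have "f' = 0"
        using lead deg True degree_eq_zeroE[of f] degree_eq_zeroE[of "monom c n * h"]
        by (metis coeff_pCons_0 diff_self f'_def)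
      thus ?thesis
        using c by (intro bexI[of _ "monom c n"] bexI[of _ 0]) (auto simp: f'_def)
    next
      case df: False
      have "degree f' < degree f"
        unfolding f'_def using df deg lead degree_diff_le[of f "degree f" "monom c n * h"]
          leading_coeff_0_iff[of "f - monom c n * h"]
        by (metis (no_types, lifting) coeff_diff diff_self degree_0 le_neq_implies_less order_refl)
      then obtain q r where "q \<in> polys_over K" "r \<in> polys_over K" "f' = q * h + r"
        "r = 0 \<or> degree r < degree h"
        using less.hyps f' by blast
      thus ?thesis
        using c by (intro bexI[of _ "q + monom c n"] bexI[of _ r])
          (auto simp: f'_def algebra_simps)
    qed
  qed
qed

text \<open>A nonzero combination of \<open>f\<close> and \<open>g\<close> of least degree divides
  both, because remainders are combinations again. Dividing its own representation by it shows that
  the cofactors are comaximal.\<close>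

lemma polys_over_bezout:
  assumes "f \<in> polys_over K" "g \<in> polys_over K" "g \<noteq> 0"
  obtains h f' g' where "f' \<in> polys_over K" "g' \<in> polys_over K" "h \<noteq> 0"
    "f = h * f'" "g = h * g'" "comaximal f' g'"
proof -
  define P where "P = (\<lambda>h. h \<noteq> 0 \<and> (\<exists>a\<in>polys_over K. \<exists>b\<in>polys_over K. h = a * f + b * g))"
  have "P g"
    unfolding P_def using assms
    by (intro conjI bexI[of _ "0 :: 'a poly"] bexI[of _ "1 :: 'a poly"]) auto
  then obtain h where "P h" and min: "\<And>h'. P h' \<Longrightarrow> degree h \<le> degree h'"
    using ex_has_least_nat[of P g degree] by blast
  then obtain a b where ab: "a \<in> polys_over K" "b \<in> polys_over K" "h = a * f + b * g"
    and "h \<noteq> 0"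
    unfolding P_def by blast
  have h: "h \<in> polys_over K"
    using ab assms by auto
  have "\<exists>q\<in>polys_over K. k = h * q"
    if k: "k = c * f + d * g" "c \<in> polys_over K" "d \<in> polys_over K" for k c d
  proof -
    have "k \<in> polys_over K"
      using k assms by auto
    then obtain q r where qr: "q \<in> polys_over K" "r \<in> polys_over K" "k = q * h + r"
      "r = 0 \<or> degree r < degree h"
      using polys_over_division[of k h] h \<open>h \<noteq> 0\<close> by blast
    have "r = (c - q * a) * f + (d - q * b) * g"
      using qr(3) k(1) ab(3) by (simp add: algebra_simps)
    hence "P r" if "r \<noteq> 0"
      unfolding P_def using that qr(1) k ab
      by (intro conjI bexI[of _ "c - q * a"] bexI[of _ "d - q * b"]) auto
    hence "r = 0"
      using min qr(4) by fastforce
    thus ?thesis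
      using qr by (auto simp: mult.commute)
  qed
  from this[of f 1 0] this[of g 0 1] obtain f' g'
    where fg: "f' \<in> polys_over K" "g' \<in> polys_over K" "f = h * f'" "g = h * g'"
    by auto
  have "h * (a * f' + b * g') = h * 1"
    using ab(3) fg by (simp add: algebra_simps)
  hence "a * f' + b * g' = 1"
    using \<open>h \<noteq> 0\<close> by (metis mult_left_cancel)
  thus ?thesis
    using that fg \<open>h \<noteq> 0\<close> unfolding comaximal_def by blast
qed

lemma adjoin_comaximal:
  assumes "r \<in> adjoin K x"
  obtains f g where "f \<in> polys_over K" "g \<in> polys_over K" "poly g x \<noteq> 0" "r = poly f x / poly g x"
    "comaximal f g"
proof -
  obtain f g where fg: "f \<in> polys_over K" "g \<in> polys_over K" "poly g x \<noteq> 0" "r = poly f x / poly g x"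
    using assms unfolding adjoin_def by blast
  hence "g \<noteq> 0"
    by auto
  then obtain h f' g' where "f' \<in> polys_over K" "g' \<in> polys_over K" "h \<noteq> 0"
    "f = h * f'" "g = h * g'" "comaximal f' g'"
    using polys_over_bezout fg by metis
  thus ?thesis
    using that[of f' g'] fg by auto
qed

lemma poly_in_adjoin: "f \<in> polys_over K \<Longrightarrow> poly f x \<in> adjoin K x"
  by (intro adjoinI[of f _ 1]) auto

lemma subset_adjoin: "c \<in> K \<Longrightarrow> c \<in> adjoin K x"
  using poly_in_adjoin[of "[:c:]"] by auto

lemma in_adjoin: "x \<in> adjoin K x"
  using poly_in_adjoin[of "[:0, 1:]"] by auto

lemma subfield_of_adjoin: "subfield_of (adjoin K x)"
proof
  show "1 \<in> adjoin K x"
    by (rule subset_adjoin) auto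
next
  fix a b assume "a \<in> adjoin K x" "b \<in> adjoin K x"
  then obtain f g f' g' where *: "f \<in> polys_over K" "g \<in> polys_over K" "poly g x \<noteq> 0"
    "f' \<in> polys_over K" "g' \<in> polys_over K" "poly g' x \<noteq> 0"
    and ab: "a = poly f x / poly g x" "b = poly f' x / poly g' x"
    unfolding adjoin_def by blast
  have "a - b = poly (f * g' - f' * g) x / poly (g * g') x"
    using * by (simp add: ab divide_simps)
  thus "a - b \<in> adjoin K x"
    using * by (intro adjoinI[of "f * g' - f' * g" _ "g * g'"]) auto
  have "a * b = poly (f * f') x / poly (g * g') x"
    using * by (simp add: ab divide_simps)
  thus "a * b \<in> adjoin K x"
    using * by (intro adjoinI[of "f * f'" _ "g * g'"]) auto
next
  fix a assume a: "a \<in> adjoin K x"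
  then obtain f g where *: "f \<in> polys_over K" "g \<in> polys_over K" "poly g x \<noteq> 0"
    and ab: "a = poly f x / poly g x"
    unfolding adjoin_def by blast
  show "inverse a \<in> adjoin K x"
  proof (cases "poly f x = 0")
    case True
    thus ?thesis
      using a ab by simp
  next
    case False
    thus ?thesis
      using * ab by (intro adjoinI[of g _ f]) auto
  qed
qed

lemma transcendental_over_eqI:
  assumes "transcendental_over K x" "f \<in> polys_over K" "g \<in> polys_over K" "poly f x = poly g x"
  shows "f = g"
proof -
  have "f - g \<in> polys_over K" "poly (f - g) x = 0"
    using assms by auto
  thus ?thesis
    using assms(1) unfolding transcendental_over_def by fastforce
qed

text \<open>Different indices may share an exponent, so terms are collected by exponent. In this
  form a relation between monomials in several elements can be split one variable at a time.\<close>

lemma transcendental_over_sum_eq_0: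
  assumes "transcendental_over K x" "finite S" "\<And>i. i \<in> S \<Longrightarrow> c i \<in> K"
    and "(\<Sum>i\<in>S. c i * x ^ e i) = 0"
  shows "(\<Sum>i\<in>{i\<in>S. e i = n}. c i) = 0"
proof -
  define f where "f = (\<Sum>i\<in>S. monom (c i) (e i))"
  have "f \<in> polys_over K"
    using assms(3) by (auto simp: f_def)
  moreover have "poly f x = 0"
    using assms(4) by (simp add: f_def poly_sum poly_monom)
  ultimately have "f = 0"
    using assms(1) by (auto simp: transcendental_over_def)
  hence "0 = coeff f n"
    by simp
  also have "\<dots> = (\<Sum>i\<in>S. if e i = n then c i else 0)"
    by (simp add: f_def coeff_sum)
  also have "\<dots> = (\<Sum>i\<in>{i\<in>S. e i = n}. c i)"
    using assms(2) by (simp add: sum.If_cases Int_def)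
  finally show ?thesis
    by simp
qed

text \<open>A nonzero annihilating polynomial of least degree, not normalised. One of no larger
  degree is proportional to it: matching the coefficients at \<open>degree f\<close> leaves a
  difference of smaller degree.\<close>

lemma not_transcendental_minimal:
  assumes "\<not> transcendental_over K x"
  obtains f where "f \<in> polys_over K" "f \<noteq> 0" "poly f x = 0" "degree f > 0"
    "\<And>g. g \<in> polys_over K \<Longrightarrow> poly g x = 0 \<Longrightarrow> degree g \<le> degree f \<Longrightarrow> \<exists>c\<in>K. g = smult c f"
    "\<And>g. g \<in> polys_over K \<Longrightarrow> poly g x = 0 \<Longrightarrow> degree g < degree f \<Longrightarrow> g = 0"
proof -
  define P where "P = (\<lambda>f. f \<in> polys_over K \<and> f \<noteq> 0 \<and> poly f x = 0)"
  obtain f0 where "P f0"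
    using assms unfolding transcendental_over_def P_def by blast
  then obtain f where f: "P f" and min: "\<And>g. P g \<Longrightarrow> degree f \<le> degree g"
    using ex_has_least_nat[of P f0 degree] by blast
  have deg: "degree f > 0"
    using f unfolding P_def by (metis gr0I degree_eq_zeroE poly_const_conv pCons_0_0)
  have less: "g = 0" if "g \<in> polys_over K" "poly g x = 0" "degree g < degree f" for g
    using min[of g] that unfolding P_def by force
  have "\<exists>c\<in>K. g = smult c f" if g: "g \<in> polys_over K" "poly g x = 0" "degree g \<le> degree f" for g
  proof -
    define c where "c = coeff g (degree f) / lead_coeff f"
    have c: "c \<in> K"
      using f g by (auto simp: c_def P_def polys_over_def)
    have 1: "g - smult c f \<in> polys_over K"
      using f g c by (auto simp: P_def)
    have 2: "poly (g - smult c f) x = 0"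
      using f g by (auto simp: P_def)
    have "degree (g - smult c f) \<le> degree f"
      using g by (simp add: degree_diff_le degree_smult_le)
    moreover have "coeff (g - smult c f) (degree f) = 0"
      using f by (simp add: c_def P_def)
    ultimately have "degree (g - smult c f) < degree f"
      using deg by (metis coeff_0 degree_0 le_neq_implies_less leading_coeff_neq_0)
    hence "g - smult c f = 0"
      using less 1 2 by blast
    thus ?thesis
      using c by auto
  qed
  thus ?thesis
    using that[of f] f deg less unfolding P_def by blast
qed

end

section \<open>Affine equations over a stable subfield\<close>

locale ring_hom_fun =
  fixes h :: "'a::comm_ring_1 \<Rightarrow> 'b::comm_ring_1"
  assumes hom_add [simp]: "h (x + y) = h x + h y"
    and hom_mult [simp]: "h (x * y) = h x * h y"
    and hom_1 [simp]: "h 1 = 1"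
begin

lemma hom_0 [simp]: "h 0 = 0"
  by (metis add_cancel_left_left add.right_neutral hom_add)

lemma hom_uminus [simp]: "h (- x) = - h x"
  using hom_add[of x "- x"] by (simp add: eq_neg_iff_add_eq_0 add.commute)

lemma hom_diff [simp]: "h (x - y) = h x - h y"
  using hom_add[of x "- y"] by simp

lemma hom_power [simp]: "h (x ^ n) = h x ^ n"
  by (induction n) auto

lemma hom_sum: "h (sum f A) = (\<Sum>i\<in>A. h (f i))"
  by (induction A rule: infinite_finite_induct) auto

lemma hom_of_nat [simp]: "h (of_nat n) = of_nat n"
  by (induction n) auto

lemma hom_numeral [simp]: "h (numeral n) = numeral n"
  using hom_of_nat[of "numeral n"] by simp

lemma coeff_map_poly_hom [simp]: "coeff (map_poly h f) n = h (coeff f n)"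
  by (simp add: coeff_map_poly)

lemma map_poly_hom_add: "map_poly h (f + g) = map_poly h f + map_poly h g"
  by (rule poly_eqI) simp

lemma map_poly_hom_mult: "map_poly h (f * g) = map_poly h f * map_poly h g"
  by (rule poly_eqI) (simp add: coeff_mult hom_sum)

lemma map_poly_hom_smult: "map_poly h (smult c f) = smult (h c) (map_poly h f)"
  by (rule poly_eqI) simp

lemma poly_map_poly_hom: "poly (map_poly h f) (h x) = h (poly f x)"
  by (induction f) (simp_all add: map_poly_pCons)

lemma map_poly_hom_pcompose: "map_poly h (pcompose f g) = pcompose (map_poly h f) (map_poly h g)"
  by (induction f)
     (simp_all add: pcompose_pCons map_poly_pCons map_poly_hom_add map_poly_hom_mult)

end

locale field_endo = ring_hom_fun s
  for s :: "'a::field \<Rightarrow> 'a"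
begin

lemma hom_eq_0_iff [simp]: "s x = 0 \<longleftrightarrow> x = 0"
proof
  assume "s x = 0"
  hence "s (x * inverse x) = 0"
    by (simp only: hom_mult) simp
  thus "x = 0"
    using right_inverse[of x] by fastforce
qed simp

lemma hom_inverse [simp]: "s (inverse x) = inverse (s x)"
proof (cases "x = 0")
  case False
  hence "s x * s (inverse x) = 1"
    by (simp flip: hom_mult)
  thus ?thesis
    by (metis inverse_unique)
qed simp

lemma hom_divide [simp]: "s (x / y) = s x / s y"
  by (simp add: divide_inverse)

lemma degree_map_poly_hom [simp]: "degree (map_poly s f) = degree f"
  by (rule degree_map_poly) simp

lemma map_poly_hom_pderiv: "map_poly s (pderiv f) = pderiv (map_poly s f)"
  by (rule poly_eqI) (simp add: coeff_pderiv del: of_nat_Suc)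

end

locale stable_subfield = subfield_of K + field_endo s
  for K :: "'a::field set" and s +
  assumes s_closed [simp, intro]: "x \<in> K \<Longrightarrow> s x \<in> K"
begin

lemma map_poly_s_closed [simp, intro]: "f \<in> polys_over K \<Longrightarrow> map_poly s f \<in> polys_over K"
  by (simp add: polys_over_def)

lemma stable_subfield_adjoin:
  assumes "s x \<in> adjoin K x"
  shows "stable_subfield (adjoin K x) s"
proof -
  interpret Kx: subfield_of "adjoin K x"
    by (rule subfield_of_adjoin)
  have *: "s (poly f x) \<in> adjoin K x" if "f \<in> polys_over K" for f
  proof -
    have "map_poly s f \<in> polys_over (adjoin K x)"
      using that subset_adjoin by (auto simp: polys_over_def)
    thus ?thesis
      unfolding poly_map_poly_hom[symmetric] using assms by (rule Kx.poly_closed)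
  qed
  show ?thesis
  proof
    fix y assume "y \<in> adjoin K x"
    then obtain f g where "f \<in> polys_over K" "g \<in> polys_over K" "y = poly f x / poly g x"
      unfolding adjoin_def by blast
    thus "s y \<in> adjoin K x"
      using * by auto
  qed
qed

text \<open>For a minimal polynomial \<open>f\<close> of \<open>x\<close>, the polynomial
  \<open>s f (X / \<gamma>)\<close> also annihilates \<open>x\<close> and is therefore proportional
  to \<open>f\<close>. Hence \<open>s\<close> multiplies the coefficient at \<open>n\<close> by
  \<open>c * \<gamma> ^ n\<close>, and the quotient of constant and leading coefficient, the norm of
  \<open>x\<close> up to sign, is the required \<open>r\<close>.\<close>

lemma mult_eq_algebraic:
  assumes x: "x = \<gamma> * s x" "x \<noteq> 0" and \<gamma>: "\<gamma> \<in> K" and alg: "\<not> transcendental_over K x"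
  obtains n r where "n > 0" "r \<in> K" "r \<noteq> 0" "r = \<gamma> ^ n * s r"
proof -
  obtain f where f: "f \<in> polys_over K" "f \<noteq> 0" "poly f x = 0" "degree f > 0"
    and le: "\<And>g. g \<in> polys_over K \<Longrightarrow> poly g x = 0 \<Longrightarrow> degree g \<le> degree f \<Longrightarrow> \<exists>c\<in>K. g = smult c f"
    and less: "\<And>g. g \<in> polys_over K \<Longrightarrow> poly g x = 0 \<Longrightarrow> degree g < degree f \<Longrightarrow> g = 0"
    using not_transcendental_minimal[OF alg] by metis
  have "\<gamma> \<noteq> 0"
    using x by auto
  have coeff0: "coeff f 0 \<noteq> 0"
  proof
    assume "coeff f 0 = 0"
    then obtain g where g: "f = pCons 0 g"
      by (cases f) auto
    hence "g \<in> polys_over K" "poly g x = 0" "degree g < degree f" "g \<noteq> 0"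
      using f x by (auto simp: polys_over_pCons_iff)
    thus False
      using less by blast
  qed
  define g where "g = pcompose (map_poly s f) [:0, 1 / \<gamma>:]"
  have "g \<in> polys_over K"
    unfolding g_def using f \<gamma> by (intro polys_over_pcompose) auto
  moreover have "poly g x = 0"
  proof -
    have "poly [:0, 1 / \<gamma>:] x = s x"
      using x \<open>\<gamma> \<noteq> 0\<close> by (simp add: divide_simps mult.commute)
    thus ?thesis
      using f by (simp only: g_def poly_pcompose poly_map_poly_hom hom_0)
  qed
  moreover have "degree g \<le> degree f"
    using degree_pcompose_le[of "map_poly s f" "[:0, 1 / \<gamma>:]"] \<open>\<gamma> \<noteq> 0\<close> by (simp add: g_def)
  ultimately obtain c where c: "c \<in> K" "g = smult c f"
    using le by blast
  have "coeff g n = s (coeff f n) / \<gamma> ^ n" for n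
    by (simp add: g_def coeff_pcompose_linear power_divide)
  hence *: "s (coeff f n) = c * \<gamma> ^ n * coeff f n" for n
    using c \<open>\<gamma> \<noteq> 0\<close> by (simp add: divide_simps ac_simps)
  have "c \<noteq> 0"
    using *[of 0] coeff0 by auto
  define r where "r = coeff f 0 / lead_coeff f"
  have "r \<in> K"
    using f by (auto simp: r_def polys_over_def)
  moreover have "r \<noteq> 0"
    using coeff0 f by (simp add: r_def)
  moreover have "r = \<gamma> ^ degree f * s r"
    using coeff0 f \<open>c \<noteq> 0\<close> \<open>\<gamma> \<noteq> 0\<close> by (simp add: r_def * divide_simps)
  ultimately show ?thesis
    using that f by blast
qed

end

lemma coeff_pcompose_linear_top:
  fixes f :: "'a::idom poly"
  assumes "degree f \<le> n"
  shows "coeff (pcompose f [:b, c:]) n = coeff f n * c ^ n"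
  using assms
proof (induction f arbitrary: n)
  case (pCons a f)
  show ?case
  proof (cases "f = 0")
    case True
    thus ?thesis
      by (cases n) (auto simp: pcompose_pCons coeff_pCons)
  next
    case False
    then obtain m where n: "n = Suc m" "degree f \<le> m"
      using pCons.prems by (cases n) auto
    have "coeff (pcompose f [:b, c:]) (Suc m) = 0"
    proof (rule coeff_eq_0)
      have "degree (pcompose f [:b, c:]) \<le> degree f * degree [:b, c:]"
        by (rule degree_pcompose_le)
      also have "\<dots> \<le> degree f * 1"
        by (intro mult_left_mono) auto
      finally show "degree (pcompose f [:b, c:]) < Suc m"
        using n by linarith
    qed
    thus ?thesis
      using n pCons.IH[of m] by (simp add: pcompose_pCons coeff_pCons)
  qed
qed auto

text \<open>
  An element with \<open>x = \<alpha> * s x + \<beta>\<close> is transcendental over a subfield in which this equation has no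
  solution: the twisted minimal polynomial \<open>s f ((X - \<beta>) / \<alpha>)\<close> is a multiple of \<open>f\<close>, and then so
  are the derivatives of \<open>f\<close>, the last nonconstant one of which has a root solving the equation.
\<close>

locale affine_equation = stable_subfield K s
  for K :: "'a::field_char_0 set" and s +
  fixes \<alpha> \<beta> x :: 'a
  assumes \<alpha>: "\<alpha> \<in> K" "\<alpha> \<noteq> 0" and \<beta>: "\<beta> \<in> K"
    and x_eq: "x = \<alpha> * s x + \<beta>"
    and no_solution: "\<And>r. r \<in> K \<Longrightarrow> r \<noteq> \<alpha> * s r + \<beta>"
begin

definition twist :: "'a poly \<Rightarrow> 'a poly" where
  "twist f = pcompose (map_poly s f) [:- \<beta> / \<alpha>, 1 / \<alpha>:]"

lemma twist_closed [simp, intro]: "f \<in> polys_over K \<Longrightarrow> twist f \<in> polys_over K"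
  unfolding twist_def using \<alpha> \<beta> by (intro polys_over_pcompose) auto

lemma poly_twist: "poly (twist f) x = s (poly f x)"
proof -
  have "poly [:- \<beta> / \<alpha>, 1 / \<alpha>:] x = s x"
    using \<alpha> arg_cong[OF x_eq, of "\<lambda>y. (y - \<beta>) / \<alpha>"] by (simp add: diff_divide_distrib)
  thus ?thesis
    by (simp only: twist_def poly_pcompose poly_map_poly_hom)
qed

lemma degree_twist [simp]: "degree (twist f) = degree f"
  unfolding twist_def using \<alpha> by (simp add: degree_pcompose)

lemma coeff_twist_top: "degree f \<le> n \<Longrightarrow> coeff (twist f) n = s (coeff f n) / \<alpha> ^ n"
  by (simp add: twist_def coeff_pcompose_linear_top power_divide)

lemma twist_pderiv: "pderiv (twist f) = smult (1 / \<alpha>) (twist (pderiv f))"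
  by (simp add: twist_def pderiv_pcompose map_poly_hom_pderiv pderiv_pCons)

lemma degree_twist_eq_smult:
  assumes "f \<in> polys_over K" "twist f = smult \<kappa> f"
  shows "degree f = 0"
  using assms
proof (induction "degree f" arbitrary: f \<kappa> rule: less_induct)
  case less
  show ?case
  proof (rule ccontr)
    assume deg: "degree f \<noteq> 0"
    show False
    proof (cases "degree f = 1")
      case False
      \<comment> \<open>Differentiation multiplies the eigenvalue by \<open>\<alpha>\<close> and, in
        characteristic zero, lowers the degree by exactly one, so the descent ends at a linear
        polynomial.\<close>
      have "twist (pderiv f) = smult (\<kappa> * \<alpha>) (pderiv f)"
        using arg_cong[OF less.prems(2), of "\<lambda>g. smult \<alpha> (pderiv g)"] \<alpha>
        by (simp add: twist_pderiv pderiv_smult mult.commute)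
      hence "degree (pderiv f) = 0"
        using less.prems(1) deg by (intro less.hyps[of "pderiv f" "\<kappa> * \<alpha>"]) (auto simp: degree_pderiv)
      thus False
        using deg False by (simp add: degree_pderiv)
    next
      case True
      then obtain a b where f: "f = [:b, a:]" "a \<noteq> 0"
        using degree1_coeffs[of f] by metis
      have ab: "a \<in> K" "b \<in> K"
        using less.prems(1) f by (auto simp: polys_over_pCons_iff)
      have "[:s b - \<beta> / \<alpha> * s a, s a / \<alpha>:] = [:\<kappa> * b, \<kappa> * a:]"
        using less.prems(2) f by (simp add: twist_def map_poly_pCons pcompose_pCons mult.commute)
      hence *: "s b - \<beta> / \<alpha> * s a = \<kappa> * b" "s a / \<alpha> = \<kappa> * a"
        by auto
      hence "\<kappa> \<noteq> 0"
        using f \<alpha> by auto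
      have sa: "s a = \<alpha> * \<kappa> * a"
        using *(2) \<alpha> by (simp add: field_simps)
      have "s b = \<kappa> * b + \<beta> / \<alpha> * s a"
        using *(1) by (simp add: algebra_simps)
      hence "s b = \<kappa> * b + \<beta> * \<kappa> * a"
        using \<alpha> unfolding sa by simp
      hence "- b / a = \<alpha> * s (- b / a) + \<beta>"
        using sa f \<alpha> \<open>\<kappa> \<noteq> 0\<close> by (simp add: field_simps)
      moreover have "- b / a \<in> K"
        using ab by auto
      ultimately show False
        using no_solution by blast
    qed
  qed
qed

lemma transcendental: "transcendental_over K x"
proof (rule ccontr)
  assume "\<not> transcendental_over K x"
  then obtain f where f: "f \<in> polys_over K" "f \<noteq> 0" "poly f x = 0" "degree f > 0"
    and le: "\<And>g. g \<in> polys_over K \<Longrightarrow> poly g x = 0 \<Longrightarrow> degree g \<le> degree f \<Longrightarrow> \<exists>c\<in>K. g = smult c f"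
    using not_transcendental_minimal by metis
  have "\<exists>c\<in>K. twist f = smult c f"
    using f by (intro le) (auto simp: poly_twist)
  thus False
    using degree_twist_eq_smult f by fastforce
qed

text \<open>The reduced denominator \<open>g\<close> divides \<open>twist g\<close>, which has the
  same degree; so \<open>g\<close> is an eigenvector of \<open>twist\<close> and hence constant. The
  equation becomes an identity of polynomials whose coefficients can be compared.\<close>

lemma adjoin_affine_solution:
  assumes r: "r \<in> adjoin K x" "r = \<gamma> * s r + poly h x" and "\<gamma> \<in> K" "h \<in> polys_over K"
  obtains f where "f \<in> polys_over K" "r = poly f x" "f = smult \<gamma> (twist f) + h"
proof -
  obtain f g where f: "f \<in> polys_over K" and g: "g \<in> polys_over K" "poly g x \<noteq> 0"
    and r': "r = poly f x / poly g x" and fg: "comaximal f g"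
    using adjoin_comaximal[OF r(1)] by metis
  have "g \<noteq> 0"
    using g by auto
  have "f * twist g = g * (smult \<gamma> (twist f) + h * twist g)"
  proof (rule transcendental_over_eqI[OF transcendental])
    have "poly f x / poly g x = \<gamma> * (s (poly f x) / s (poly g x)) + poly h x"
      using r(2) unfolding r' by simp
    thus "poly (f * twist g) x = poly (g * (smult \<gamma> (twist f) + h * twist g)) x"
      using g by (simp add: poly_twist field_simps)
  qed (use assms f g in auto)
  hence "g dvd f * twist g"
    by simp
  hence "g dvd twist g"
    using fg comaximal_sym comaximal_dvd_mult by blast
  then obtain k where k: "twist g = g * k" ..
  have "twist g \<noteq> 0"
    using poly_twist[of g] g by fastforce
  hence "degree k = 0"
    using k degree_mult_eq[of g k] degree_twist[of g] by auto
  then obtain \<kappa> where "k = [:\<kappa>:]"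
    by (rule degree_eq_zeroE)
  hence "degree g = 0"
    using k g by (intro degree_twist_eq_smult[of g \<kappa>]) auto
  then obtain c where c: "g = [:c:]"
    by (rule degree_eq_zeroE)
  define f' where "f' = smult (1 / c) f"
  have cK: "c \<in> K" "c \<noteq> 0"
    using c g by (auto simp: polys_over_pCons_iff)
  have f': "f' \<in> polys_over K" "r = poly f' x"
    using cK f r' c by (auto simp: f'_def)
  have "f' = smult \<gamma> (twist f') + h"
    by (rule transcendental_over_eqI[OF transcendental])
       (use assms f' in \<open>auto simp: poly_twist\<close>)
  thus ?thesis
    using that f' by blast
qed

text \<open>In the homogeneous case the polynomial representing \<open>r\<close> is itself an
  eigenvector of \<open>twist\<close>, hence constant. This lets solutions descend in the
  tower.\<close>

lemma adjoin_linear_solution: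
  assumes "r \<in> adjoin K x" "r = \<gamma> * s r" "\<gamma> \<in> K"
  shows "r \<in> K"
proof (cases "r = 0")
  case False
  obtain f where f: "f \<in> polys_over K" "r = poly f x" "f = smult \<gamma> (twist f) + 0"
    using adjoin_affine_solution[of r \<gamma> 0] assms by auto
  have "\<gamma> \<noteq> 0"
    using assms False by auto
  hence "twist f = smult (1 / \<gamma>) f"
    using arg_cong[OF f(3), of "smult (1 / \<gamma>)"] by simp
  hence "degree f = 0"
    using f degree_twist_eq_smult by blast
  then obtain c where "f = [:c:]"
    by (rule degree_eq_zeroE)
  thus ?thesis
    using f by (auto simp: polys_over_pCons_iff)
qed auto

end

section \<open>Invariant curves of the Riccati equation\<close>

text \<open>
  \<open>mobius_transform s d p N f\<close> is \<open>(p - X) ^ N\<close> times the value of \<open>s f\<close> at \<open>d / (p - X)\<close>.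
\<close>

definition mobius_transform ::
    "('a::comm_ring_1 \<Rightarrow> 'a) \<Rightarrow> 'a \<Rightarrow> 'a \<Rightarrow> nat \<Rightarrow> 'a poly \<Rightarrow> 'a poly" where
  "mobius_transform s d p N f =
     pcompose (\<Sum>k\<le>N. monom (s (coeff f k) * d ^ k) (N - k)) [:p, -1:]"

lemma poly_mobius_transform:
  "poly (mobius_transform s d p N f) y = (\<Sum>k\<le>N. s (coeff f k) * d ^ k * (p - y) ^ (N - k))"
  by (simp add: mobius_transform_def poly_pcompose poly_sum poly_monom)

lemma pcompose_linear_involution:
  fixes f :: "'a::comm_ring_1 poly"
  shows "pcompose (pcompose f [:p, -1:]) [:p, -1:] = f"
proof -
  have "pcompose [:p, -1:] [:p, -1:] = [:0, 1:]"
    by (simp add: pcompose_pCons)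
  thus ?thesis
    by (metis pcompose_assoc pcompose_idR)
qed

lemma pcompose_power:
  fixes f g :: "'a::comm_ring_1 poly"
  shows "pcompose (f ^ n) g = pcompose f g ^ n"
  by (induction n) (simp_all only: power_0 power_Suc pcompose_mult pcompose_1)

lemma coeff_sum_monom_rev:
  assumes "n \<le> N"
  shows "coeff (\<Sum>k\<le>N. monom (c k) (N - k)) (N - n) = (c n :: 'a::comm_monoid_add)"
proof -
  have "coeff (\<Sum>k\<le>N. monom (c k) (N - k)) (N - n) = (\<Sum>k\<le>N. if k = n then c k else 0)"
    unfolding coeff_sum by (intro sum.cong) (use assms in auto)
  thus ?thesis
    using assms by simp
qed

lemma degree_sum_monom_rev: "degree (\<Sum>k\<le>N. monom (c k) (N - k)) \<le> N"
  by (intro degree_sum_le) (auto intro: degree_monom_le le_trans)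

lemma degree_mobius_transform: "degree (mobius_transform s d p N f) \<le> N"
proof -
  have "degree (mobius_transform s d p N f) \<le> N * degree [:p, -1:]"
    unfolding mobius_transform_def
    by (rule order_trans[OF degree_pcompose_le]) (intro mult_right_mono degree_sum_monom_rev, simp)
  also have "\<dots> = N"
    by simp
  finally show ?thesis .
qed

lemma coeff_mobius_transform_top:
  fixes d p :: "'a::idom"
  shows "coeff (mobius_transform s d p N f) N = (- 1) ^ N * s (coeff f 0)"
  using coeff_sum_monom_rev[of 0 N "\<lambda>k. s (coeff f k) * d ^ k"]
  by (simp add: mobius_transform_def coeff_pcompose_linear_top degree_sum_monom_rev mult.commute)

lemma mobius_transform_smult:
  assumes "\<And>x. s (c * x) = s c * s x"
  shows "mobius_transform s d p N (smult c f) = smult (s c) (mobius_transform s d p N f)"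
proof -
  have "(\<Sum>k\<le>N. monom (s (coeff (smult c f) k) * d ^ k) (N - k)) =
        smult (s c) (\<Sum>k\<le>N. monom (s (coeff f k) * d ^ k) (N - k))"
    by (rule poly_eqI) (auto simp: coeff_sum sum_distrib_left assms mult.assoc intro!: sum.cong)
  thus ?thesis
    by (simp add: mobius_transform_def pcompose_smult)
qed

lemma mobius_transform_add_degree:
  assumes "degree f \<le> N" "s 0 = 0"
  shows "mobius_transform s d p (N + n) f = [:p, -1:] ^ n * mobius_transform s d p N f"
proof -
  have "(\<Sum>k\<le>N + n. monom (s (coeff f k) * d ^ k) (N + n - k)) =
        (\<Sum>k\<le>N. monom (s (coeff f k) * d ^ k) (N + n - k))"
    using assms by (intro sum.mono_neutral_right) (auto simp: coeff_eq_0)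
  also have "\<dots> = monom 1 n * (\<Sum>k\<le>N. monom (s (coeff f k) * d ^ k) (N - k))"
    unfolding sum_distrib_left by (intro sum.cong refl) (simp add: mult_monom add.commute)
  finally have *: "(\<Sum>k\<le>N + n. monom (s (coeff f k) * d ^ k) (N + n - k)) =
      [:0, 1:] ^ n * (\<Sum>k\<le>N. monom (s (coeff f k) * d ^ k) (N - k))"
    by (simp add: monom_altdef)
  have "pcompose ([:0, 1:] ^ n) [:p, -1:] = [:p, -1:] ^ n"
    by (simp add: pcompose_power pcompose_pCons)
  thus ?thesis
    unfolding mobius_transform_def * by (simp add: pcompose_mult)
qed

text \<open>Undoing the shift from \<open>X\<close> to \<open>p - X\<close> preserves divisibility
  by constants and leaves a polynomial with the coefficients
  \<open>s (coeff f k) * d ^ k\<close>.\<close>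

lemma const_dvd_mobius_transform:
  fixes c :: "'a::idom"
  assumes "[:c:] dvd mobius_transform s d p N f" "k \<le> N"
  shows "c dvd s (coeff f k) * d ^ k"
proof -
  obtain g where "mobius_transform s d p N f = [:c:] * g"
    using assms(1) ..
  hence "pcompose (mobius_transform s d p N f) [:p, -1:] = [:c:] * pcompose g [:p, -1:]"
    by (simp add: pcompose_smult)
  hence "[:c:] dvd (\<Sum>k\<le>N. monom (s (coeff f k) * d ^ k) (N - k))"
    unfolding mobius_transform_def pcompose_linear_involution by (metis dvd_triv_left)
  hence "c dvd coeff (\<Sum>k\<le>N. monom (s (coeff f k) * d ^ k) (N - k)) (N - k)"
    using const_poly_dvd_iff by blast
  thus ?thesis
    using coeff_sum_monom_rev[OF assms(2), of "\<lambda>k. s (coeff f k) * d ^ k"] by simp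
qed

lemma poly_eq_sum_atMost:
  fixes x :: "'a::comm_semiring_1"
  assumes "degree f \<le> N"
  shows "poly f x = (\<Sum>k\<le>N. coeff f k * x ^ k)"
  unfolding poly_altdef using assms by (intro sum.mono_neutral_left) (auto simp: coeff_eq_0)

text \<open>Formulated with degree bounds instead of degrees, so that a top coefficient may
  vanish.\<close>

lemma coeff_mult_degree_le:
  fixes f g :: "'a::comm_ring_1 poly"
  assumes "degree f \<le> m" "degree g \<le> n"
  shows "coeff (f * g) (m + n) = coeff f m * coeff g n"
proof -
  have "coeff (f * g) (m + n) = (\<Sum>i\<le>m + n. coeff f i * coeff g (m + n - i))"
    by (simp add: coeff_mult)
  also have "\<dots> = (\<Sum>i\<in>{m}. coeff f i * coeff g (m + n - i))"
  proof (intro sum.mono_neutral_right ballI)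
    fix i assume "i \<in> {..m + n} - {m}"
    hence "i > m \<or> m + n - i > n"
      by auto
    thus "coeff f i * coeff g (m + n - i) = 0"
      using assms by (auto simp: coeff_eq_0)
  qed auto
  finally show ?thesis
    by simp
qed

lemma coeff_power_degree_le:
  fixes f :: "'a::comm_ring_1 poly"
  assumes "degree f \<le> n"
  shows "coeff (f ^ k) (n * k) = coeff f n ^ k" and "degree (f ^ k) \<le> n * k"
proof -
  show deg: "degree (f ^ k) \<le> n * k" for k
    using degree_power_le[of f k] assms by (metis le_trans mult_le_mono1)
  show "coeff (f ^ k) (n * k) = coeff f n ^ k"
  proof (induction k)
    case (Suc k)
    thus ?case
      using coeff_mult_degree_le[OF assms deg[of k]] by simp
  qed simp
qed

section \<open>Moebius eigenvectors with coefficients in C[x]\<close>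

abbreviation (input) subst_pow4 :: "'a::comm_semiring_1 poly \<Rightarrow> 'a poly" where
  "subst_pow4 f \<equiv> pcompose f (monom 1 4)"

text \<open>\<open>M\<close> divides every \<open>subst_pow4 (coeff R k) * monom 1 4 ^ k\<close>,
  and the coefficients of a primitive \<open>R\<close> have no common zero. So \<open>M\<close> can
  vanish only at 0, with order at most \<open>4 * N\<close> because some coefficient is nonzero at
  0.\<close>

lemma primitive_mobius_eigenvalue:
  fixes R :: "complex poly poly"
  assumes R: "content R = 1" "degree R \<le> N"
    and eq: "mobius_transform subst_pow4 (monom 1 4) p N R = smult M R"
  obtains c m where "c \<noteq> 0" "m \<le> 4 * N" "M = monom c m"
proof -
  have root: "\<exists>k\<le>N. poly (coeff R k) x \<noteq> 0" for x
  proof (rule ccontr)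
    assume "\<not> (\<exists>k\<le>N. poly (coeff R k) x \<noteq> 0)"
    hence "[:- x, 1:] dvd coeff R k" for k
      using R(2) by (cases "k \<le> N") (auto simp: coeff_eq_0 poly_eq_0_iff_dvd)
    hence "[:- x, 1:] dvd content R"
      by (simp add: const_poly_dvd_iff flip: const_poly_dvd_iff_dvd_content)
    thus False
      using R(1) by (simp add: is_unit_iff_degree)
  qed
  have dvd: "M dvd subst_pow4 (coeff R k) * monom 1 4 ^ k" if "k \<le> N" for k
    using that eq by (intro const_dvd_mobius_transform[of _ _ _ p N]) (auto simp: const_poly_dvd_iff)
  have "M \<noteq> 0"
  proof
    assume "M = 0"
    obtain k where "k \<le> N" "poly (coeff R k) 1 \<noteq> 0"
      using root by blast
    thus False
      using dvd[of k] \<open>M = 0\<close> by (metis dvd_0_left_iff mult_eq_0_iff monom_eq_0_iff one_neq_zero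
          pcompose_eq_0 poly_0 power_eq_0_iff degree_monom_eq zero_less_numeral)
  qed
  then obtain Q where Q: "M = [:- 0, 1:] ^ order 0 M * Q" "\<not> [:- 0, 1:] dvd Q"
    using order_decomp by blast
  define m where "m = order 0 M"
  have M: "M = monom 1 m * Q"
    using Q by (simp add: m_def monom_altdef)
  have "poly Q x \<noteq> 0" for x
  proof
    assume x: "poly Q x = 0"
    hence "x \<noteq> 0"
      using Q(2) by (metis poly_eq_0_iff_dvd)
    \<comment> \<open>The substitution relates a zero \<open>x\<close> of \<open>Q\<close> to the
      values of the coefficients at \<open>x ^ 4\<close>, not all of which are zero.\<close>
    obtain k where k: "k \<le> N" "poly (coeff R k) (x ^ 4) \<noteq> 0"
      using root by blast
    obtain h where "subst_pow4 (coeff R k) * monom 1 4 ^ k = M * h"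
      using dvd[OF k(1)] ..
    hence "poly (subst_pow4 (coeff R k) * monom 1 4 ^ k) x = 0"
      using x M by simp
    thus False
      using k(2) \<open>x \<noteq> 0\<close> by (simp add: poly_pcompose poly_monom)
  qed
  hence "degree Q = 0"
    using fundamental_theorem_of_algebra[of Q] constant_degree[of Q] by blast
  then obtain c where c: "Q = [:c:]"
    by (rule degree_eq_zeroE)
  have "M = monom c m"
    using M c by (simp add: monom_altdef)
  moreover have "c \<noteq> 0"
    using \<open>M = monom c m\<close> \<open>M \<noteq> 0\<close> by auto
  moreover have "m \<le> 4 * N"
  proof (rule ccontr)
    assume "\<not> m \<le> 4 * N"
    obtain k where k: "k \<le> N" "poly (coeff R k) 0 \<noteq> 0"
      using root by blast
    obtain h where "subst_pow4 (coeff R k) * monom 1 4 ^ k = M * h"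
      using dvd[OF k(1)] ..
    \<comment> \<open>As \<open>4 * k < m\<close>, the right side has no term in this degree; the
      left side has the constant term of \<open>coeff R k\<close> there.\<close>
    hence "coeff (monom 1 (4 * k) * subst_pow4 (coeff R k)) (4 * k) = coeff (monom c m * h) (4 * k)"
      using \<open>M = monom c m\<close> by (simp add: monom_power mult.commute)
    thus False
      using k \<open>\<not> m \<le> 4 * N\<close> by (simp add: coeff_monom_mult coeff_monom poly_0_coeff_0)
  qed
  ultimately show ?thesis
    using that by blast
qed

text \<open>
  The substitution \<open>y = \<eta> x\<^sup>2\<close> isolates the terms that dominate as \<open>x \<rightarrow> \<infinity>\<close>. They show that
  every branch \<open>y\<close> of \<open>R(x, y) = 0\<close> grows at least like \<open>x\<^sup>2\<close>: the only other growth rate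
  compatible with \<open>y(x) = p(x) - x\<^sup>4 / y(x\<^sup>4)\<close> is \<open>y \<sim> x\<^bsup>1/2\<^esup>\<close>, but the conjugate branch
  \<open>y \<sim> - x\<^bsup>1/2\<^esup>\<close> is mapped to \<open>2 x\<^sup>2\<close>.
\<close>

lemma mobius_eigenvector_branches:
  fixes R :: "complex poly poly"
  assumes R: "R \<noteq> 0" "degree R \<le> N" and c: "c \<noteq> 0"
    and eq: "mobius_transform subst_pow4 (monom 1 4) [:1, 1, 1:] N R = smult (monom c m) R"
  shows "coeff R 0 \<noteq> 0" "degree (coeff R N) + 2 * N \<le> degree (coeff R 0)"
proof -
  define r where "r = coeff R"
  define K where "K = {k. k \<le> N \<and> r k \<noteq> 0}"
  have "finite K"
    by (simp add: K_def)
  have "lead_coeff R \<noteq> 0"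
    using R by simp
  hence "degree R \<in> K"
    using R by (simp add: K_def r_def)
  hence "K \<noteq> {}"
    by blast
  \<comment> \<open>After \<open>y = \<eta> x\<^sup>2\<close> the term of index \<open>k\<close> on
    the transformed side has degree at most \<open>4 * degree (r k) + 2 * k + 2 * N\<close>, so
    \<open>w + 2 * N\<close> bounds the degree of that side.\<close>
  define w where "w = Max ((\<lambda>k. 4 * degree (r k) + 2 * k) ` K)"
  have w_ge: "4 * degree (r k) + 2 * k \<le> w" if "k \<in> K" for k
    unfolding w_def using \<open>finite K\<close> that by simp
  have "w \<in> (\<lambda>k. 4 * degree (r k) + 2 * k) ` K"
    unfolding w_def using \<open>finite K\<close> \<open>K \<noteq> {}\<close> by (intro Max_in) auto
  then obtain k1 where k1: "k1 \<in> K" "w = 4 * degree (r k1) + 2 * k1"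
    by blast
  \<comment> \<open>\<open>e k\<close> is what \<open>r k\<close> contributes in degree
    \<open>w + 2 * N\<close> of the transformed side, up to a power of \<open>1 - \<eta>\<close>; it
    is nonzero exactly when \<open>k\<close> attains the maximum \<open>w\<close>. Up to
    \<open>c\<close>, \<open>b n k\<close> is the coefficient of \<open>\<eta> ^ k\<close> in degree
    \<open>n\<close> of the other side.\<close>
  define e where "e k = coeff (subst_pow4 (r k) * monom 1 4 ^ k) (w + 2 * k)" for k
  define b where "b n k = coeff (monom 1 (m + 2 * k) * r k) n" for n k
  have deg4: "degree (subst_pow4 (r k) * monom 1 4 ^ k) = 4 * degree (r k) + 4 * k" if "k \<in> K" for k
    using that by (subst degree_mult_eq)
      (auto simp: K_def degree_pcompose degree_monom_eq monom_power pcompose_eq_0)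
  have e_neq_0: "e k \<noteq> 0 \<longleftrightarrow> w = 4 * degree (r k) + 2 * k" if "k \<in> K" for k
  proof
    assume "e k \<noteq> 0"
    hence "w + 2 * k \<le> 4 * degree (r k) + 4 * k"
      unfolding e_def deg4[OF that, symmetric] by (rule le_degree)
    thus "w = 4 * degree (r k) + 2 * k"
      using w_ge[OF that] by simp
  next
    assume w: "w = 4 * degree (r k) + 2 * k"
    have "subst_pow4 (r k) * monom 1 4 ^ k \<noteq> 0"
      using that by (auto simp: K_def pcompose_eq_0 degree_monom_eq)
    hence "lead_coeff (subst_pow4 (r k) * monom 1 4 ^ k) \<noteq> 0"
      by simp
    thus "e k \<noteq> 0"
      using w deg4[OF that] by (simp add: e_def add.commute)
  qed
  have e_K: "k \<in> K" if "e k \<noteq> 0" "k \<le> N" for k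
    using that by (auto simp: K_def e_def)
  have b_K: "k \<in> K" if "b n k \<noteq> 0" "k \<le> N" for n k
    using that by (auto simp: K_def b_def)
  have deg_term: "degree (subst_pow4 (r k) * monom 1 4 ^ k) \<le> w + 2 * k" for k
  proof (cases "k \<in> K")
    case True
    thus ?thesis
      using deg4 w_ge[of k] by simp
  next
    case False
    thus ?thesis
      using R by (cases "k \<le> N") (auto simp: K_def r_def coeff_eq_0)
  qed
  have deg_q: "degree [:1, 1, 1 - \<eta>:] \<le> 2" for \<eta> :: complex
    by (simp add: degree_pCons_eq_if)
  have sub: "(\<Sum>k\<le>N. subst_pow4 (r k) * monom 1 4 ^ k * [:1, 1, 1 - \<eta>:] ^ (N - k)) =
      (\<Sum>k\<le>N. smult (c * \<eta> ^ k) (monom 1 (m + 2 * k) * r k))" (is "?A \<eta> = ?B \<eta>") for \<eta>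
  proof -
    have "?A \<eta> = poly (mobius_transform subst_pow4 (monom 1 4) [:1, 1, 1:] N R) (monom \<eta> 2)"
      unfolding poly_mobius_transform r_def
      by (simp add: monom_altdef numeral_2_eq_2)
    also have "\<dots> = monom c m * poly R (monom \<eta> 2)"
      unfolding eq by simp
    also have "\<dots> = (\<Sum>k\<le>N. monom c m * (r k * monom \<eta> 2 ^ k))"
      using R(2) by (simp add: poly_eq_sum_atMost r_def sum_distrib_left)
    also have "\<dots> = ?B \<eta>"
    proof (intro sum.cong refl)
      fix k
      have "smult (c * \<eta> ^ k) (monom 1 (m + 2 * k) * r k) = monom (c * \<eta> ^ k) (m + 2 * k) * r k"
        by (metis mult.right_neutral mult_smult_left smult_monom)
      thus "monom c m * (r k * monom \<eta> 2 ^ k) = smult (c * \<eta> ^ k) (monom 1 (m + 2 * k) * r k)"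
        by (simp add: monom_power mult_monom ac_simps)
    qed
    finally show ?thesis .
  qed
  have coeff_A: "coeff (?A \<eta>) (w + 2 * N) = (\<Sum>k\<le>N. e k * (1 - \<eta>) ^ (N - k))" for \<eta>
  proof -
    have "coeff (subst_pow4 (r k) * monom 1 4 ^ k * [:1, 1, 1 - \<eta>:] ^ (N - k)) (w + 2 * N) =
          e k * (1 - \<eta>) ^ (N - k)" if "k \<le> N" for k
    proof -
      have "coeff (subst_pow4 (r k) * monom 1 4 ^ k * [:1, 1, 1 - \<eta>:] ^ (N - k))
              ((w + 2 * k) + 2 * (N - k)) = e k * coeff ([:1, 1, 1 - \<eta>:] ^ (N - k)) (2 * (N - k))"
        unfolding e_def
        by (intro coeff_mult_degree_le deg_term coeff_power_degree_le(2)[OF deg_q])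
      moreover have "(w + 2 * k) + 2 * (N - k) = w + 2 * N"
        using that by simp
      moreover have "coeff ([:1, 1, 1 - \<eta>:] ^ (N - k)) (2 * (N - k)) = (1 - \<eta>) ^ (N - k)"
        by (subst coeff_power_degree_le(1)[OF deg_q]) (simp add: numeral_2_eq_2)
      ultimately show ?thesis
        by simp
    qed
    thus ?thesis
      by (simp add: coeff_sum)
  qed
  have coeff_A': "coeff (?A \<eta>) n = 0" if "n > w + 2 * N" for n \<eta>
  proof -
    have "degree (?A \<eta>) \<le> w + 2 * N"
    proof (intro degree_sum_le)
      fix k assume "k \<in> {..N}"
      have "degree (subst_pow4 (r k) * monom 1 4 ^ k * [:1, 1, 1 - \<eta>:] ^ (N - k))
          \<le> (w + 2 * k) + 2 * (N - k)"
        by (intro order_trans[OF degree_mult_le] add_mono deg_term coeff_power_degree_le(2)[OF deg_q])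
      thus "degree (subst_pow4 (r k) * monom 1 4 ^ k * [:1, 1, 1 - \<eta>:] ^ (N - k)) \<le> w + 2 * N"
        using \<open>k \<in> {..N}\<close> by simp
    qed auto
    thus ?thesis
      using that by (intro coeff_eq_0) auto
  qed
  have coeff_B: "coeff (?B \<eta>) n = c * (\<Sum>k\<le>N. b n k * \<eta> ^ k)" for n \<eta>
    by (simp add: coeff_sum b_def sum_distrib_left ac_simps)
  \<comment> \<open>Coefficients beyond degree \<open>w + 2 * N\<close> vanish for all values of
    \<open>\<eta>\<close>, hence separately for each power of \<open>\<eta>\<close>; so no single
    term of the right side exceeds this degree.\<close>
  have deg_le: "m + 2 * k + degree (r k) \<le> w + 2 * N" if "k \<in> K" for k
  proof (rule ccontr)
    define n where "n = m + 2 * k + degree (r k)"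
    assume "\<not> m + 2 * k + degree (r k) \<le> w + 2 * N"
    hence "c * (\<Sum>k\<le>N. b n k * \<eta> ^ k) = 0" for \<eta>
      using coeff_A'[of n \<eta>] coeff_B[of \<eta> n] by (simp add: sub n_def)
    hence "poly (\<Sum>k\<le>N. monom (b n k) k) \<eta> = poly 0 \<eta>" for \<eta>
      using c by (simp add: poly_sum poly_monom)
    hence "(\<Sum>k\<le>N. monom (b n k) k) = 0"
      unfolding poly_eq_poly_eq_iff[symmetric] by (rule ext)
    hence "coeff (\<Sum>k\<le>N. monom (b n k) k) k = 0"
      by simp
    hence "b n k = 0"
      using that by (simp add: coeff_sum K_def)
    thus False
      using that by (simp add: b_def n_def coeff_monom_mult K_def)
  qed

  \<comment> \<open>The dominant coefficients of both sides as polynomials, \<open>E\<close> in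
    \<open>1 - \<eta>\<close> and \<open>J\<close> in \<open>\<eta>\<close>; they agree up to the
    factor \<open>c\<close>.\<close>
  define J where "J = (\<Sum>k\<le>N. monom (b (w + 2 * N) k) k)"
  define E where "E = (\<Sum>k\<le>N. monom (e k) (N - k))"
  have "poly (pcompose E [:1, -1:]) \<eta> = poly (smult c J) \<eta>" for \<eta>
    using coeff_A[of \<eta>] coeff_B[of \<eta> "w + 2 * N"]
    by (simp add: sub E_def J_def poly_pcompose poly_sum poly_monom)
  hence EJ: "pcompose E [:1, -1:] = smult c J"
    unfolding poly_eq_poly_eq_iff[symmetric] by (rule ext)
  hence JE: "E = smult c (pcompose J [:1, -1:])"
    by (metis pcompose_linear_involution pcompose_smult)
  define S where "S = {k. k \<le> N \<and> e k \<noteq> 0}"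
  have "k1 \<in> S"
    using k1 e_neq_0 by (simp add: S_def K_def)
  have "finite S"
    by (simp add: S_def)
  define k0 where "k0 = Max S"
  have "k0 \<in> S"
    unfolding k0_def using \<open>finite S\<close> \<open>k1 \<in> S\<close> by (intro Max_in) auto
  hence k0: "k0 \<le> N" "k0 \<in> K" "w = 4 * degree (r k0) + 2 * k0"
    using e_K e_neq_0 by (auto simp: S_def)
  have S_le: "k \<le> k0" if "e k \<noteq> 0" "k \<le> N" for k
    unfolding k0_def using that \<open>finite S\<close> by (intro Max_ge) (auto simp: S_def)
  \<comment> \<open>Indices attaining \<open>w\<close> have equal parity, which makes the polynomial
    \<open>Q\<close> below even. This is the conjugation of the branches that grow like the square
    root of \<open>x\<close>.\<close>
  have S_parity: "even (k + k0)" if "e k \<noteq> 0" "k \<le> N" for k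
  proof -
    have "4 * degree (r k) + 2 * k = 4 * degree (r k0) + 2 * k0"
      using that e_K e_neq_0 k0 by metis
    thus ?thesis
      by presburger
  qed
  define Q where "Q = (\<Sum>k\<le>k0. monom (e k) (k0 - k))"
  have EQ: "E = monom 1 (N - k0) * Q"
  proof -
    have "e k = 0" if "k \<le> N" "k0 < k" for k
      using S_le[of k] that by force
    hence "E = (\<Sum>k\<le>k0. monom (e k) (N - k))"
      unfolding E_def using k0(1) by (intro sum.mono_neutral_right) auto
    also have "\<dots> = monom 1 (N - k0) * Q"
      unfolding Q_def sum_distrib_left using k0(1)
      by (intro sum.cong refl) (simp add: mult_monom)
    finally show ?thesis .
  qed
  have coeff_E: "coeff E (N - k0) = e k0"
    unfolding E_def by (rule coeff_sum_monom_rev) (fact k0(1))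
  hence "E \<noteq> 0"
    using \<open>k0 \<in> S\<close> by (auto simp: S_def)
  hence "Q \<noteq> 0" "J \<noteq> 0"
    using EQ JE by auto
  have deg_Q: "degree Q \<le> k0"
    unfolding Q_def by (rule degree_sum_monom_rev)
  have Q_neg: "pcompose Q [:0, -1:] = Q"
    unfolding Q_def pcompose_sum
  proof (intro sum.cong refl)
    fix k assume "k \<in> {..k0}"
    show "pcompose (monom (e k) (k0 - k)) [:0, -1:] = monom (e k) (k0 - k)"
    proof (cases "e k = 0")
      case False
      hence "even (k0 - k)"
        using S_parity[of k] \<open>k \<in> {..k0}\<close> k0(1) by simp
      thus ?thesis
        by (intro poly_eqI) (auto simp: coeff_pcompose_linear)
    qed simp
  qed

  \<comment> \<open>A zero of \<open>J\<close> of order \<open>\<mu>\<close> at 0 gives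
    \<open>E\<close>, hence \<open>Q\<close>, a zero of at least this order at 1. Evenness repeats
    it at -1, so that \<open>2 * \<mu> \<le> degree Q \<le> k0\<close>.\<close>
  define \<mu> where "\<mu> = order 0 J"
  obtain J' where J': "J = [:- 0, 1:] ^ \<mu> * J'" "\<not> [:- 0, 1:] dvd J'"
    using order_decomp[OF \<open>J \<noteq> 0\<close>, of 0] unfolding \<mu>_def by blast
  have J'_mult: "J = monom 1 \<mu> * J'"
    using J' by (simp add: monom_altdef)
  have "coeff J' 0 \<noteq> 0"
    using J'(2) by (metis poly_0_coeff_0 poly_eq_0_iff_dvd)
  hence "coeff J \<mu> \<noteq> 0"
    using J'_mult by (simp add: coeff_monom_mult)
  moreover have "coeff J \<mu> = (if \<mu> \<le> N then b (w + 2 * N) \<mu> else 0)"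
    by (simp add: J_def coeff_sum)
  ultimately have \<mu>: "\<mu> \<le> N" "b (w + 2 * N) \<mu> \<noteq> 0"
    by (auto split: if_splits)
  hence "\<mu> \<in> K"
    using b_K by blast
  have deg_\<mu>: "w + 2 * N = m + 2 * \<mu> + degree (r \<mu>)"
  proof -
    have "w + 2 * N \<le> degree (monom 1 (m + 2 * \<mu>) * r \<mu>)"
      using \<mu>(2) unfolding b_def by (rule le_degree)
    also have "\<dots> \<le> m + 2 * \<mu> + degree (r \<mu>)"
      by (intro order_trans[OF degree_mult_le] add_mono degree_monom_le order_refl)
    finally show ?thesis
      using deg_le[OF \<open>\<mu> \<in> K\<close>] by linarith
  qed
  have "[:- 1, 1:] ^ \<mu> dvd E"
  proof -
    have "pcompose ([:0, 1:] ^ \<mu>) [:1, -1:] = [:1, -1 :: complex:] ^ \<mu>"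
      by (simp add: pcompose_power pcompose_pCons)
    moreover have "[:1, -1:] = - [:-1, 1 :: complex:]"
      by simp
    hence "[:-1, 1 :: complex:] ^ \<mu> dvd [:1, -1:] ^ \<mu>"
      by (metis dvd_power_same dvd_minus_iff dvd_refl)
    ultimately show ?thesis
      unfolding JE using J'(1) by (simp add: pcompose_mult dvd_smult)
  qed
  hence "\<mu> \<le> order 1 E"
    using \<open>E \<noteq> 0\<close> by (simp add: order_divides)
  also have "\<dots> = order 1 (monom 1 (N - k0) :: complex poly) + order 1 Q"
    unfolding EQ using \<open>E \<noteq> 0\<close> EQ by (intro order_mult) auto
  also have "order 1 (monom 1 (N - k0) :: complex poly) = 0"
    by (intro order_0I) (simp add: poly_monom)
  finally have ord1: "\<mu> \<le> order 1 Q"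
    by simp
  have "[:- 1, 1:] ^ \<mu> dvd Q"
    using ord1 by (simp add: order_divides)
  then obtain Q' where "Q = [:- 1, 1:] ^ \<mu> * Q'" ..
  hence "Q = pcompose ([:- 1, 1:] ^ \<mu>) [:0, -1:] * pcompose Q' [:0, -1:]"
    using Q_neg by (metis pcompose_mult)
  moreover have "pcompose ([:- 1, 1:] ^ \<mu>) [:0, -1:] = [:- 1, - 1 :: complex:] ^ \<mu>"
    by (simp add: pcompose_power pcompose_pCons)
  ultimately have "[:- 1, - 1:] ^ \<mu> dvd Q"
    by simp
  moreover have "[:- 1, - 1 :: complex:] = - [:- (- 1), 1:]"
    by simp
  hence "[:- (- 1), 1 :: complex:] ^ \<mu> dvd [:- 1, - 1:] ^ \<mu>"
    by (metis dvd_power_same dvd_minus_iff dvd_refl)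
  ultimately have "[:- (- 1), 1:] ^ \<mu> dvd Q"
    by (rule dvd_trans[rotated])
  hence ord2: "\<mu> \<le> order (- 1) Q"
    using \<open>Q \<noteq> 0\<close> by (simp only: order_divides simp_thms)
  have "2 * \<mu> \<le> k0"
  proof (cases "\<mu> = 0")
    case False
    have fin: "finite {x. poly Q x = 0}"
      using \<open>Q \<noteq> 0\<close> by (rule poly_roots_finite)
    have "order 1 Q + order (- 1) Q = (\<Sum>x\<in>{1, - 1}. order x Q)"
      by simp
    also have "\<dots> \<le> (\<Sum>x | poly Q x = 0. order x Q)"
      using False ord1 ord2 by (intro sum_mono2 fin) (auto simp: order_root)
    also have "\<dots> \<le> k0"
      using sum_order_le_degree[OF \<open>Q \<noteq> 0\<close>] deg_Q by linarith
    finally show ?thesis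
      using ord1 ord2 by linarith
  qed auto
  \<comment> \<open>\<open>deg_le\<close> at \<open>k0\<close> and the maximality of
    \<open>w\<close> at \<open>\<mu>\<close> combine to \<open>k0 \<le> \<mu>\<close>, which is
    compatible with \<open>2 * \<mu> \<le> k0\<close> only if both are 0.\<close>
  have "\<mu> = 0"
    using deg_le[OF k0(2)] deg_\<mu> w_ge[OF \<open>\<mu> \<in> K\<close>] k0(3) \<open>2 * \<mu> \<le> k0\<close> by linarith
  thus R0: "coeff R 0 \<noteq> 0"
    using \<open>\<mu> \<in> K\<close> by (simp add: K_def r_def)
  have "coeff (smult (monom c m) R) N = (- 1) ^ N * subst_pow4 (coeff R 0)"
    unfolding eq[symmetric] by (rule coeff_mobius_transform_top)
  moreover have "subst_pow4 (coeff R 0) \<noteq> 0"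
    using R0 by (simp add: pcompose_eq_0_iff degree_monom_eq)
  ultimately have "coeff R N \<noteq> 0"
    by auto
  hence "N \<in> K"
    by (simp add: K_def r_def)
  thus "degree (coeff R N) + 2 * N \<le> degree (coeff R 0)"
    using deg_le[of N] deg_\<mu> \<open>\<mu> = 0\<close> by (simp add: r_def)
qed

text \<open>For the primitive part the eigenvalue is a polynomial, hence a monomial of degree
  \<open>m\<close>. The coefficients at \<open>N\<close> give
  \<open>4 * degree (coeff R' 0) = m + degree (coeff R' N)\<close>. Together with
  \<open>m \<le> 4 * N\<close> and
  \<open>degree (coeff R' N) + 2 * N \<le> degree (coeff R' 0)\<close> this forces
  \<open>N = 0\<close>.\<close>

lemma no_mobius_eigenvector_poly:
  fixes R :: "complex poly poly"
  assumes "R \<noteq> 0" "degree R \<le> N" "N > 0" "D \<noteq> 0"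
  shows "smult D (mobius_transform subst_pow4 (monom 1 4) [:1, 1, 1:] N R) \<noteq> smult M R"
proof
  let ?T = "mobius_transform subst_pow4 (monom 1 4) [:1, 1, 1 :: complex:] N"
  assume eq: "smult D (?T R) = smult M R"
  define R' where "R' = primitive_part R"
  define g where "g = content R"
  have g: "R = smult g R'" "g \<noteq> 0"
    using assms by (simp_all add: g_def R'_def)
  have "degree R = degree R'"
    by (subst g(1)) (simp add: g(2))
  hence R': "content R' = 1" "R' \<noteq> 0" "degree R' \<le> N"
    using assms(1,2) by (simp_all add: R'_def)
  define D' where "D' = D * subst_pow4 g"
  define M' where "M' = M * g"
  have "D' \<noteq> 0"
    using assms g by (simp add: D'_def pcompose_eq_0_iff degree_monom_eq)
  have eq': "smult D' (?T R') = smult M' R'"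
    using eq unfolding g(1) by (simp add: mobius_transform_smult pcompose_mult D'_def M'_def)
  have "[:D':] dvd smult M' R'"
    unfolding eq'[symmetric] by (simp add: const_poly_dvd_iff)
  hence "D' dvd content (smult M' R')"
    by (simp only: const_poly_dvd_iff_dvd_content)
  hence "D' dvd M'"
    using R' by simp
  then obtain L where L: "M' = D' * L" ..
  have "smult D' (?T R') = smult D' (smult L R')"
    unfolding eq' L by simp
  hence "D' * coeff (?T R') i = D' * coeff (smult L R') i" for i
    by (metis coeff_smult)
  hence eq'': "?T R' = smult L R'"
    using \<open>D' \<noteq> 0\<close> by (intro poly_eqI) (metis mult_left_cancel)
  obtain c m where c: "c \<noteq> 0" "m \<le> 4 * N" "L = monom c m"
    by (rule primitive_mobius_eigenvalue[OF R'(1,3) eq''])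
  note * = mobius_eigenvector_branches[OF R'(2,3) c(1) eq''[unfolded c(3)]]
  have "coeff (smult L R') N = (- 1) ^ N * subst_pow4 (coeff R' 0)"
    unfolding eq''[symmetric] by (rule coeff_mobius_transform_top)
  hence "degree (monom c m * coeff R' N) = degree ((- 1) ^ N * subst_pow4 (coeff R' 0))"
    using c by simp
  also have "\<dots> = 4 * degree (coeff R' 0)"
    by (cases "even N") (simp_all add: degree_pcompose degree_monom_eq)
  finally have "4 * degree (coeff R' 0) \<le> m + degree (coeff R' N)"
    using degree_mult_le[of "monom c m" "coeff R' N"] degree_monom_eq[OF c(1), of m] by linarith
  thus False
    using *(2) c(2) assms(3) by linarith
qed

section \<open>Riccati equations over a stable subfield\<close>

text \<open>\<open>no_eigenvector\<close> excludes invariant curves of the Riccati equation.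
  \<open>N\<close> may exceed \<open>degree f\<close>: the point at infinity then counts with
  multiplicity \<open>N - degree f\<close>.\<close>

locale mobius_equation = stable_subfield K s
  for K :: "'a::field_char_0 set" and s +
  fixes d p u :: 'a
  assumes d: "d \<in> K" "d \<noteq> 0" and p: "p \<in> K"
    and u_eq: "u = p - d / s u" and u_neq_0: "u \<noteq> 0"
    and no_eigenvector:
      "\<And>f N \<kappa>. f \<in> polys_over K \<Longrightarrow> f \<noteq> 0 \<Longrightarrow> degree f \<le> N \<Longrightarrow> N > 0 \<Longrightarrow> \<kappa> \<in> K \<Longrightarrow>
         mobius_transform s d p N f \<noteq> smult \<kappa> f"
begin

abbreviation T where "T \<equiv> mobius_transform s d p"

abbreviation q where "q \<equiv> [:p, -1:]"

lemma p_minus_u: "p - u = d / s u"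
  by (subst (1) u_eq) simp

lemma p_minus_u_neq_0: "p - u \<noteq> 0"
  using d u_neq_0 by (simp add: p_minus_u)

lemma s_u: "s u = d / (p - u)"
  using d u_neq_0 by (simp add: p_minus_u)

lemma T_closed [intro]: "f \<in> polys_over K \<Longrightarrow> T N f \<in> polys_over K"
  unfolding mobius_transform_def using d p
  by (intro polys_over_pcompose polys_over_sum polys_over_monom mult_closed power_closed s_closed)
     (auto simp: polys_over_def coeff_pCons split: nat.split)

lemma poly_T:
  assumes "degree f \<le> N" "y \<noteq> p"
  shows "poly (T N f) y = (p - y) ^ N * poly (map_poly s f) (d / (p - y))"
proof -
  have "(p - y) ^ N * poly (map_poly s f) (d / (p - y)) =
        (\<Sum>k\<le>N. (p - y) ^ N * (s (coeff f k) * (d / (p - y)) ^ k))"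
    using assms by (subst poly_eq_sum_atMost[of _ N]) (auto simp: sum_distrib_left)
  also have "\<dots> = poly (T N f) y"
    unfolding poly_mobius_transform using assms(2)
    by (intro sum.cong refl) (simp add: power_divide power_diff)
  finally show ?thesis ..
qed

lemma poly_T_u: "degree f \<le> N \<Longrightarrow> poly (T N f) u = (p - u) ^ N * s (poly f u)"
  using poly_T[of f N u] p_minus_u_neq_0 poly_map_poly_hom[of f u] by (simp add: s_u)

text \<open>The substitution sends \<open>p\<close> to infinity, so only the leading coefficient of
  \<open>f\<close> survives there. Hence \<open>q\<close> does not divide a transform taken with the
  exact degree.\<close>

lemma poly_T_p:
  assumes "f \<noteq> 0"
  shows "poly (T (degree f) f) p \<noteq> 0"
proof -
  have "poly (T (degree f) f) p = (\<Sum>k\<in>{degree f}. s (coeff f k) * d ^ k * (p - p) ^ (degree f - k))"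
    unfolding poly_mobius_transform by (intro sum.mono_neutral_right) auto
  thus ?thesis
    using assms d by simp
qed

text \<open>Clearing denominators in the transformed Bezout identity yields a combination equal to a
  power of \<open>q\<close>, and \<open>T (degree f) f\<close> is comaximal to such powers.\<close>

lemma comaximal_T:
  assumes "comaximal f g" "f \<noteq> 0"
  shows "comaximal (T (degree f) f) (T (degree g) g)"
proof -
  obtain a b where ab: "a * f + b * g = 1"
    using assms(1) unfolding comaximal_def by blast
  define n where "n = degree a + degree f + degree b + degree g"
  define A where "A = T (n - degree f) a"
  define B where "B = T (n - degree g) b"
  have "A * T (degree f) f + B * T (degree g) g - q ^ n = 0" (is "?P = 0")
  proof (rule ccontr)
    assume "?P \<noteq> 0"
    \<comment> \<open>The identity holds wherever the substitution is defined, that is, at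
      infinitely many points.\<close>
    have "poly ?P y = 0" if "y \<noteq> p" for y
    proof -
      define y' where "y' = d / (p - y)"
      have "poly ?P y = (p - y) ^ ((n - degree f) + degree f) * (poly (map_poly s a) y' * poly (map_poly s f) y') +
          (p - y) ^ ((n - degree g) + degree g) * (poly (map_poly s b) y' * poly (map_poly s g) y') - (p - y) ^ n"
        unfolding power_add A_def B_def using that
        by (simp add: poly_T n_def y'_def algebra_simps)
      also have "\<dots> = (p - y) ^ n * (poly (map_poly s (a * f + b * g)) y' - 1)"
        by (simp add: n_def map_poly_hom_add map_poly_hom_mult algebra_simps)
      finally show ?thesis
        by (simp add: ab)
    qed
    hence "UNIV - {p} \<subseteq> {y. poly ?P y = 0}"
      by auto
    hence "finite (UNIV - {p} :: 'a set)"
      using poly_roots_finite[OF \<open>?P \<noteq> 0\<close>] by (rule finite_subset)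
    thus False
      using infinite_UNIV_char_0[where 'a = 'a] by simp
  qed
  hence qn: "q ^ n = A * T (degree f) f + B * T (degree g) g"
    by simp
  have "comaximal (T (degree f) f) (q ^ n)"
    using assms poly_T_p by (intro comaximal_power comaximal_linear) auto
  then obtain x y where "x * T (degree f) f + y * q ^ n = 1"
    unfolding comaximal_def by blast
  hence "(x + y * A) * T (degree f) f + (y * B) * T (degree g) g = 1"
    unfolding qn by (simp add: algebra_simps)
  thus ?thesis
    unfolding comaximal_def by blast
qed

lemma transcendental: "transcendental_over K u"
proof (rule ccontr)
  assume "\<not> transcendental_over K u"
  then obtain f where f: "f \<in> polys_over K" "f \<noteq> 0" "poly f u = 0" "degree f > 0"
    and le: "\<And>g. g \<in> polys_over K \<Longrightarrow> poly g u = 0 \<Longrightarrow> degree g \<le> degree f \<Longrightarrow> \<exists>c\<in>K. g = smult c f"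
    using not_transcendental_minimal by metis
  have "\<exists>c\<in>K. T (degree f) f = smult c f"
    using f by (intro le) (auto simp: poly_T_u degree_mobius_transform)
  thus False
    using no_eigenvector f by blast
qed

text \<open>Split off the zero at \<open>p\<close>: up to sign, \<open>g = q ^ n * k\<close> with
  \<open>k\<close> prime to \<open>q\<close>. Then \<open>k\<close> and
  \<open>T (degree g) g\<close> divide each other, so \<open>g\<close> is an eigenvector for
  \<open>degree g + n\<close>: the zero of order \<open>n\<close> at \<open>p\<close> is balanced by
  multiplicity \<open>n\<close> at infinity.\<close>

lemma degree_eq_0_if_T_dvd:
  assumes g: "g \<in> polys_over K" "g \<noteq> 0"
    and dvd: "g dvd T (degree g) g * q ^ A" "T (degree g) g dvd g * q ^ B"
  shows "degree g = 0"
proof -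
  define g' where "g' = T (degree g) g"
  define n where "n = order p g"
  obtain k where k: "g = [:- p, 1:] ^ n * k" "\<not> [:- p, 1:] dvd k"
    using order_decomp[OF g(2)] unfolding n_def by blast
  have "poly k p \<noteq> 0"
    using k(2) by (simp add: poly_eq_0_iff_dvd)
  have "[:- p, 1:] = smult (- 1) q"
    by simp
  hence gk: "g = smult ((- 1) ^ n) (q ^ n * k)"
    using k(1) by (simp only: smult_power mult_smult_left)
  have "k dvd g' * q ^ A"
    using dvd(1) k(1) g'_def by (metis dvd_mult_right)
  moreover have "comaximal k (q ^ A)"
    using \<open>poly k p \<noteq> 0\<close> by (intro comaximal_power comaximal_linear)
  ultimately have "k dvd g'"
    by (metis comaximal_dvd_mult mult.commute)
  have "g * q ^ B = smult ((- 1) ^ n) (q ^ (n + B) * k)"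
    by (subst gk) (simp add: power_add ac_simps)
  hence "g' dvd q ^ (n + B) * k"
    using dvd(2) by (simp add: g'_def dvd_smult_iff)
  moreover have "comaximal g' (q ^ (n + B))"
    unfolding g'_def using poly_T_p[OF g(2)] by (intro comaximal_power comaximal_linear)
  ultimately have "g' dvd k"
    by (metis comaximal_dvd_mult)
  obtain h where h: "g' = k * h"
    using \<open>k dvd g'\<close> ..
  have "g' \<noteq> 0"
    using poly_T_p[OF g(2)] g'_def by fastforce
  have "k \<noteq> 0"
    using h \<open>g' \<noteq> 0\<close> by auto
  have "degree h = 0"
    using dvd_imp_degree_le[OF \<open>g' dvd k\<close> \<open>k \<noteq> 0\<close>] h \<open>g' \<noteq> 0\<close> degree_mult_eq[of k h] by auto
  then obtain \<kappa>0 where \<kappa>0: "h = [:\<kappa>0:]"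
    by (rule degree_eq_zeroE)
  define \<kappa> where "\<kappa> = (- 1) ^ n * \<kappa>0"
  have T: "T (degree g + n) g = smult \<kappa> g"
  proof -
    have "T (degree g + n) g = q ^ n * g'"
      unfolding g'_def by (intro mobius_transform_add_degree) auto
    also have "\<dots> = smult \<kappa>0 (q ^ n * k)"
      using h \<kappa>0 by simp
    also have "\<dots> = smult \<kappa> (smult ((- 1) ^ n) (q ^ n * k))"
      by (simp add: \<kappa>_def mult.commute[of _ \<kappa>0] mult.assoc flip: power_mult_distrib)
    finally show ?thesis
      unfolding gk[symmetric] .
  qed
  \<comment> \<open>\<open>\<kappa>\<close> arose from a divisibility over the ambient field;
    leading coefficients show that it lies in \<open>K\<close>.\<close>
  have "T (degree g + n) g \<in> polys_over K"
    using g by blast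
  hence "\<kappa> * lead_coeff g \<in> K" "lead_coeff g \<in> K"
    using g unfolding T by (auto simp: polys_over_def)
  hence "\<kappa> * lead_coeff g / lead_coeff g \<in> K"
    by blast
  hence "\<kappa> \<in> K"
    using g by simp
  show ?thesis
    using no_eigenvector[OF g, of "degree g + n" \<kappa>] T \<open>\<kappa> \<in> K\<close> by (cases "degree g = 0") auto
qed

text \<open>The reduced denominator and its transform divide each other up to powers of
  \<open>q\<close>, so \<open>r\<close> has no poles in \<open>u\<close>. If \<open>degree f\<close>
  exceeded \<open>e + l\<close>, the term with \<open>s r\<close> would have a pole of order greater
  than \<open>l\<close> at \<open>u = p\<close>, and nothing could cancel it.\<close>

lemma adjoin_solution:
  assumes r: "r \<in> adjoin K u" "r \<noteq> 0"
    and eq: "r = c * (p - u) powi e * s r + poly h u / (p - u) ^ l"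
    and c: "c \<in> K" "c \<noteq> 0" and h: "h \<in> polys_over K"
  obtains f where "f \<in> polys_over K" "r = poly f u" "int (degree f) \<le> e + int l"
proof -
  obtain f g where f: "f \<in> polys_over K" and g: "g \<in> polys_over K" "poly g u \<noteq> 0"
    and r': "r = poly f u / poly g u" and fg: "comaximal f g"
    using adjoin_comaximal[OF r(1)] by metis
  have "g \<noteq> 0" "f \<noteq> 0"
    using g r(2) r' by auto
  define f' where "f' = T (degree f) f"
  define g' where "g' = T (degree g) g"
  \<comment> \<open>The exponent of \<open>p - u\<close> that remains when \<open>s r\<close> is
    written with the transforms of \<open>f\<close> and \<open>g\<close>, split into
    \<open>int i - int j\<close> to obtain natural exponents.\<close>
  define a where "a = e + int (degree g) - int (degree f)"
  define i where "i = nat a"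
  define j where "j = nat (- a)"
  define v where "v = p - u"
  have "v \<noteq> 0"
    using p_minus_u_neq_0 by (simp add: v_def)
  have vu: "poly q u = v"
    by (simp add: v_def)
  have fu: "poly f' u = v ^ degree f * s (poly f u)" and gu: "poly g' u = v ^ degree g * s (poly g u)"
    by (simp_all add: f'_def g'_def poly_T_u v_def)
  have gu_neq_0: "poly g' u \<noteq> 0"
    using g \<open>v \<noteq> 0\<close> by (simp add: gu)
  have v_power: "v powi e * v ^ degree g / v ^ degree f = v ^ i / v ^ j"
  proof -
    have "v powi e * v ^ degree g / v ^ degree f = v powi a"
      using \<open>v \<noteq> 0\<close> by (simp add: a_def power_int_add power_int_diff)
    also have "a = int i - int j"
      by (simp add: i_def j_def)
    also have "v powi (int i - int j) = v ^ i / v ^ j"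
      using \<open>v \<noteq> 0\<close> by (simp add: power_int_diff)
    finally show ?thesis .
  qed
  have "v powi e * s r = v ^ i / v ^ j * (poly f' u / poly g' u)"
    unfolding v_power[symmetric] r' fu gu using \<open>v \<noteq> 0\<close> g by simp
  hence *: "poly f u / poly g u = c * (v ^ i / v ^ j * (poly f' u / poly g' u)) + poly h u / v ^ l"
    using eq unfolding r'[symmetric] v_def[symmetric] by (simp only: mult.assoc)
  have poly_eq: "f * (g' * q ^ (j + l)) = g * (smult c (q ^ (i + l) * f') + g' * (h * q ^ j))"
  proof (rule transcendental_over_eqI[OF transcendental])
    have "poly f u * (poly g' u * (v ^ j * v ^ l)) =
        (poly f u / poly g u) * (poly g u * poly g' u * v ^ j * v ^ l)"
      using g by simp
    also have "\<dots> = poly g u * (c * (v ^ i * v ^ l * poly f' u) + poly g' u * (poly h u * v ^ j))"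
      unfolding * using \<open>v \<noteq> 0\<close> g gu_neq_0 by (simp add: field_simps)
    finally show "poly (f * (g' * q ^ (j + l))) u =
        poly (g * (smult c (q ^ (i + l) * f') + g' * (h * q ^ j))) u"
      by (simp only: poly_mult poly_add poly_smult poly_power vu power_add)
    have "q \<in> polys_over K"
      using p by auto
    thus "f * (g' * q ^ (j + l)) \<in> polys_over K"
      "g * (smult c (q ^ (i + l) * f') + g' * (h * q ^ j)) \<in> polys_over K"
      using f g h c T_closed[OF f] T_closed[OF g(1)]
      by (auto simp: f'_def g'_def)
  qed
  have "degree g = 0"
  proof (rule degree_eq_0_if_T_dvd[OF g(1) \<open>g \<noteq> 0\<close>])
    have "g dvd f * (g' * q ^ (j + l))"
      unfolding poly_eq by simp
    thus "g dvd T (degree g) g * q ^ (j + l)"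
      using fg comaximal_sym comaximal_dvd_mult unfolding g'_def by blast
    have "g' dvd g * (smult c (q ^ (i + l) * f') + g' * (h * q ^ j))"
      unfolding poly_eq[symmetric] by (simp add: dvd_mult)
    hence "g' dvd g * smult c (q ^ (i + l) * f')"
      by (simp add: distrib_left dvd_add_left_iff dvd_mult del: mult_smult_right)
    hence "g' dvd f' * (g * q ^ (i + l))"
      using c by (simp add: dvd_smult_iff ac_simps)
    moreover have "comaximal g' f'"
      unfolding f'_def g'_def using fg \<open>f \<noteq> 0\<close> comaximal_T comaximal_sym by blast
    ultimately show "T (degree g) g dvd g * q ^ (i + l)"
      using comaximal_dvd_mult g'_def by blast
  qed
  then obtain \<gamma> where \<gamma>: "g = [:\<gamma>:]"
    by (rule degree_eq_zeroE)
  hence "\<gamma> \<in> K" "\<gamma> \<noteq> 0"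
    using g by (auto simp: polys_over_pCons_iff)
  have "int (degree f) \<le> e + int l"
  proof (rule ccontr)
    assume "\<not> ?thesis"
    hence "j > l" "i = 0"
      using \<open>degree g = 0\<close> by (auto simp: i_def j_def a_def)
    then obtain j' where j': "j = l + Suc j'"
      by (metis add_Suc_right less_iff_Suc_add)
    have "q ^ l * (f * (g' * q ^ j)) = q ^ l * (g * (smult c f' + g' * (h * q ^ Suc j')))"
      using poly_eq unfolding j' \<open>i = 0\<close> by (simp add: power_add algebra_simps)
    hence "f * (g' * q ^ j) = g * (smult c f' + g' * (h * q ^ Suc j'))"
      by (subst (asm) mult_left_cancel) auto
    hence "poly (f * (g' * q ^ j)) p = poly (g * (smult c f' + g' * (h * q ^ Suc j'))) p"
      by simp
    moreover have "(0 :: 'a) ^ j = 0"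
      by (simp add: j')
    ultimately have "poly f' p = 0"
      using \<gamma> \<open>\<gamma> \<noteq> 0\<close> c by (simp add: poly_power)
    thus False
      using poly_T_p[OF \<open>f \<noteq> 0\<close>] by (simp add: f'_def)
  qed
  moreover have "smult (1 / \<gamma>) f \<in> polys_over K" "r = poly (smult (1 / \<gamma>) f) u"
    using f \<open>\<gamma> \<in> K\<close> r' \<gamma> by auto
  ultimately show ?thesis
    using that[of "smult (1 / \<gamma>) f"] \<open>\<gamma> \<noteq> 0\<close> by simp
qed

end

section \<open>Rational functions\<close>

unbundle fps_syntax

abbreviation (input) mahler :: "complex fls \<Rightarrow> complex fls" where
  "mahler f \<equiv> fls_compose_power f 4"

definition fls_of_poly :: "complex poly \<Rightarrow> complex fls" where
  "fls_of_poly P = fps_to_fls (fps_of_poly P)"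

interpretation fls_of_poly: ring_hom_fun fls_of_poly
  by standard (simp_all add: fls_of_poly_def fps_of_poly_add fps_of_poly_mult fls_times_fps_to_fls)

lemma fls_of_poly_eq_iff [simp]: "fls_of_poly P = fls_of_poly Q \<longleftrightarrow> P = Q"
  by (simp add: fls_of_poly_def fps_of_poly_eq_iff)

lemma fls_of_poly_eq_0_iff [simp]: "fls_of_poly P = 0 \<longleftrightarrow> P = 0"
  using fls_of_poly_eq_iff[of P 0] by simp

lemma fls_of_poly_monom: "fls_of_poly (monom 1 n) = fls_X ^ n"
  by (simp add: fls_of_poly_def fps_of_poly_monom' fps_to_fls_power)

lemma fls_of_poly_X: "fls_of_poly [:0, 1:] = fls_X"
  by (simp add: fls_of_poly_def)

lemma fls_of_poly_pCons: "fls_of_poly (pCons c P) = fls_const c + fls_X * fls_of_poly P"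
  by (simp add: fls_of_poly_def fps_of_poly_pCons fls_times_fps_to_fls mult.commute)

lemma fls_of_poly_subst_pow4: "fls_of_poly (subst_pow4 P) = mahler (fls_of_poly P)"
  by (simp add: fls_of_poly_def fps_of_poly_pcompose fps_of_poly_monom' fls_compose_power_fps_to_fls)

lemma mahler_X: "mahler fls_X = fls_X ^ 4"
  using fls_of_poly_subst_pow4[of "[:0, 1:]"]
  by (simp add: pcompose_pCons fls_of_poly_monom fls_of_poly_X)

interpretation rat: stable_subfield complex_rational_functions mahler
proof
  have *: "complex_rational_functions = {fls_of_poly P / fls_of_poly Q | P Q. Q \<noteq> 0}"
    by (simp add: complex_rational_functions_def fls_of_poly_def)
  show "1 \<in> complex_rational_functions"
    unfolding * by (auto intro!: exI[of _ 1])
  fix x y assume "x \<in> complex_rational_functions" "y \<in> complex_rational_functions"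
  then obtain P Q P' Q' where Q: "Q \<noteq> 0" "Q' \<noteq> 0"
    and x: "x = fls_of_poly P / fls_of_poly Q" and y: "y = fls_of_poly P' / fls_of_poly Q'"
    unfolding * by blast
  have "x - y = fls_of_poly (P * Q' - P' * Q) / fls_of_poly (Q * Q')"
    using Q by (simp add: x y divide_simps)
  thus "x - y \<in> complex_rational_functions"
    unfolding * using Q by (intro CollectI exI[of _ "P * Q' - P' * Q"] exI[of _ "Q * Q'"]) auto
  have "x * y = fls_of_poly (P * P') / fls_of_poly (Q * Q')"
    by (simp add: x y)
  thus "x * y \<in> complex_rational_functions"
    unfolding * using Q by (intro CollectI exI[of _ "P * P'"] exI[of _ "Q * Q'"]) auto
  show "inverse x \<in> complex_rational_functions"
  proof (cases "P = 0")
    case True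
    thus ?thesis
      unfolding * using x by (intro CollectI exI[of _ 0] exI[of _ 1]) auto
  next
    case False
    thus ?thesis
      unfolding * using x by (intro CollectI exI[of _ Q] exI[of _ P]) auto
  qed
  have "mahler x * mahler (fls_of_poly Q) = mahler (fls_of_poly P)"
    using Q x by (simp flip: fls_compose_power_mult)
  moreover have "subst_pow4 Q \<noteq> 0"
    using Q by (simp add: pcompose_eq_0_iff degree_monom_eq)
  ultimately have "mahler x = fls_of_poly (subst_pow4 P) / fls_of_poly (subst_pow4 Q)"
    by (simp add: fls_of_poly_subst_pow4[symmetric] nonzero_eq_divide_eq)
  thus "mahler x \<in> complex_rational_functions"
    unfolding * using \<open>subst_pow4 Q \<noteq> 0\<close> by blast
qed auto

lemma complex_rational_functionsE:
  assumes "x \<in> complex_rational_functions"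
  obtains P Q where "Q \<noteq> 0" "x = fls_of_poly P / fls_of_poly Q"
  using assms unfolding complex_rational_functions_def fls_of_poly_def by blast

lemma fls_of_poly_in_rational_functions: "fls_of_poly P \<in> complex_rational_functions"
proof -
  have "fls_of_poly P = fls_of_poly P / fls_of_poly 1"
    by simp
  thus ?thesis
    unfolding complex_rational_functions_def fls_of_poly_def by fastforce
qed

lemma fls_X_in_rational_functions [simp, intro]: "fls_X \<in> complex_rational_functions"
  using fls_of_poly_in_rational_functions[of "[:0, 1:]"] by (simp add: fls_of_poly_X)

lemma clear_denominators:
  assumes "f \<in> polys_over complex_rational_functions"
  obtains Q R where "Q \<noteq> 0" "smult (fls_of_poly Q) f = map_poly fls_of_poly R"
  using assms
proof (induction f arbitrary: thesis)
  case 0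
  show ?case
    by (rule 0(1)[of 1 0]) auto
next
  case (pCons c f)
  have c: "c \<in> complex_rational_functions" and f: "f \<in> polys_over complex_rational_functions"
    using pCons.prems(2) by (auto simp: rat.polys_over_pCons_iff)
  obtain a b where ab: "b \<noteq> 0" "c = fls_of_poly a / fls_of_poly b"
    using c by (rule complex_rational_functionsE)
  obtain Q R where QR: "Q \<noteq> 0" "smult (fls_of_poly Q) f = map_poly fls_of_poly R"
    using pCons.IH f by blast
  have "smult (fls_of_poly (b * Q)) (pCons c f) = map_poly fls_of_poly (pCons (a * Q) (smult b R))"
    using ab QR(2)[symmetric]
    by (simp add: map_poly_pCons fls_of_poly.map_poly_hom_smult mult.commute)
  thus ?case
    using pCons.prems(1)[of "b * Q"] ab(1) QR(1) by simp
qed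

definition mahler_p :: "complex fls" where "mahler_p = 1 + fls_X + fls_X ^ 2"

lemma fls_of_poly_p: "fls_of_poly [:1, 1, 1:] = mahler_p"
  by (simp add: fls_of_poly_pCons mahler_p_def power2_eq_square algebra_simps)

lemma mahler_p_in_rational_functions [simp, intro]: "mahler_p \<in> complex_rational_functions"
  by (metis fls_of_poly_p fls_of_poly_in_rational_functions)

lemma mobius_transform_fls_of_poly:
  "mobius_transform mahler (fls_X ^ 4) mahler_p N (map_poly fls_of_poly R) =
   map_poly fls_of_poly (mobius_transform subst_pow4 (monom 1 4) [:1, 1, 1:] N R)"
proof -
  have sum: "map_poly fls_of_poly (sum f A) = (\<Sum>i\<in>A. map_poly fls_of_poly (f i))" for f and A :: "nat set"
    by (induction A rule: infinite_finite_induct) (simp_all add: fls_of_poly.map_poly_hom_add)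
  have "(\<Sum>k\<le>N. monom (mahler (coeff (map_poly fls_of_poly R) k) * (fls_X ^ 4) ^ k) (N - k)) =
    map_poly fls_of_poly (\<Sum>k\<le>N. monom (subst_pow4 (coeff R k) * monom 1 4 ^ k) (N - k))"
    unfolding sum by (simp add: map_poly_monom fls_of_poly_subst_pow4 fls_of_poly_monom)
  moreover have "map_poly fls_of_poly [:[:1, 1, 1:], -1:] = [:mahler_p, -1:]"
    by (simp add: map_poly_pCons fls_of_poly_p)
  ultimately show ?thesis
    unfolding mobius_transform_def fls_of_poly.map_poly_hom_pcompose by simp
qed

text \<open>Clearing the denominators of \<open>f\<close> and \<open>\<kappa>\<close> leaves a
  factor on the transformed side, which the multiplier \<open>D\<close> of
  \<open>no_mobius_eigenvector_poly\<close> absorbs.\<close>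

lemma no_rational_mobius_eigenvector:
  assumes f: "f \<in> polys_over complex_rational_functions" "f \<noteq> 0" "degree f \<le> N" "N > 0"
    and \<kappa>: "\<kappa> \<in> complex_rational_functions"
  shows "mobius_transform mahler (fls_X ^ 4) mahler_p N f \<noteq> smult \<kappa> f"
proof
  assume eq: "mobius_transform mahler (fls_X ^ 4) mahler_p N f = smult \<kappa> f"
  obtain Q R where Q: "Q \<noteq> 0" and QR: "smult (fls_of_poly Q) f = map_poly fls_of_poly R"
    using f(1) by (rule clear_denominators)
  obtain n m where m: "m \<noteq> 0" and nm: "\<kappa> = fls_of_poly n / fls_of_poly m"
    using \<kappa> by (rule complex_rational_functionsE)
  let ?T = "mobius_transform subst_pow4 (monom 1 4) [:1, 1, 1 :: complex:] N"
  have "map_poly fls_of_poly (?T R) = smult (mahler (fls_of_poly Q)) (smult \<kappa> f)"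
    unfolding mobius_transform_fls_of_poly[symmetric] QR[symmetric]
    by (simp add: mobius_transform_smult eq)
  hence "smult (fls_of_poly (m * Q)) (map_poly fls_of_poly (?T R)) =
         smult (fls_of_poly m * \<kappa> * mahler (fls_of_poly Q)) (smult (fls_of_poly Q) f)"
    by (simp add: ac_simps)
  also have "fls_of_poly m * \<kappa> = fls_of_poly n"
    using m nm by simp
  also have "smult (fls_of_poly n * mahler (fls_of_poly Q)) (smult (fls_of_poly Q) f) =
      map_poly fls_of_poly (smult (n * subst_pow4 Q) R)"
    by (simp only: QR fls_of_poly.map_poly_hom_smult fls_of_poly.hom_mult fls_of_poly_subst_pow4)
  finally have "map_poly fls_of_poly (smult (m * Q) (?T R)) =
      map_poly fls_of_poly (smult (n * subst_pow4 Q) R)"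
    by (simp only: fls_of_poly.map_poly_hom_smult)
  hence "smult (m * Q) (?T R) = smult (n * subst_pow4 Q) R"
    by (metis (no_types, lifting) fls_of_poly.coeff_map_poly_hom fls_of_poly_eq_iff poly_eqI)
  moreover have "degree R = degree f"
    using arg_cong[OF QR, of degree] Q by (simp add: degree_map_poly)
  moreover have "R \<noteq> 0"
    using QR f(2) Q by auto
  ultimately show False
    using no_mobius_eigenvector_poly[of R N "m * Q" "n * subst_pow4 Q"] f m Q by simp
qed

text \<open>Substituting \<open>1 / X\<close> for the variable gives the expansion at infinity, with
  \<open>X\<close> as local parameter. Fourth powers commute with inversion, so
  \<open>subst_pow4\<close> still becomes \<open>mahler\<close>.\<close>

definition fls_at_infinity :: "complex poly \<Rightarrow> complex fls" where
  "fls_at_infinity P = poly (map_poly fls_const P) fls_X_inv"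

interpretation fls_const: ring_hom_fun "fls_const :: complex \<Rightarrow> complex fls"
  by standard (simp_all flip: fls_plus_const)

interpretation fls_at_infinity: ring_hom_fun fls_at_infinity
  by standard (simp_all add: fls_at_infinity_def fls_const.map_poly_hom_add fls_const.map_poly_hom_mult)

lemma fls_at_infinity_pCons:
  "fls_at_infinity (pCons c P) = fls_const c + fls_X_inv * fls_at_infinity P"
  by (simp add: fls_at_infinity_def map_poly_pCons)

lemma fls_at_infinity_subst_pow4: "fls_at_infinity (subst_pow4 P) = mahler (fls_at_infinity P)"
proof (induction P)
  case (pCons c P)
  have X4: "fls_at_infinity (monom 1 4) = fls_X_inv ^ 4"
    by (simp add: fls_at_infinity_def map_poly_monom poly_monom)
  have "mahler fls_X_inv = fls_X_inv ^ 4"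
    by (intro fls_eqI) (auto simp: fls_nth_compose_power)
  moreover have "subst_pow4 (pCons c P) = [:c:] + monom 1 4 * subst_pow4 P"
    by (rule pcompose_pCons)
  ultimately show ?case
    using pCons.IH by (simp only: fls_at_infinity.hom_add fls_at_infinity.hom_mult X4) 
      (simp add: fls_at_infinity_pCons)
qed (simp add: fls_at_infinity_def)

lemma fls_at_infinity_neq_0:
  assumes "P \<noteq> 0"
  shows "fls_at_infinity P \<noteq> 0"
proof -
  have "fls_at_infinity P = (\<Sum>i\<le>degree (map_poly fls_const P). fls_const (coeff P i) * fls_X_inv ^ i)"
    by (simp add: fls_at_infinity_def poly_altdef)
  also have "degree (map_poly fls_const P) = degree P"
    by (rule degree_map_poly) auto
  finally have "fls_at_infinity P $$ (- int (degree P)) = lead_coeff P"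
    by (simp add: fls_nth_sum if_distrib[of "\<lambda>x. _ * x"] cong: if_cong)
  thus ?thesis
    using assms by auto
qed

text \<open>Lowest terms are compared. If \<open>r\<^sub>0\<close> has order
  \<open>e \<le> 0\<close>, the second equation forces order \<open>16 * e - 1\<close> on
  \<open>r\<^sub>1\<close>, and the first then contains an uncancelled term from
  \<open>mahler r\<^sub>1\<close>. Otherwise the second equation gives
  \<open>r\<^sub>1 $$ 1 = 2\<close>, whereas the first gives
  \<open>5 * r\<^sub>1 $$ 1 = 4\<close>.\<close>

lemma no_solution_at_infinity:
  fixes r\<^sub>0 r\<^sub>1 :: "complex fls"
  assumes 1: "fls_X ^ 3 * r\<^sub>1 = 4 * fls_X ^ 4 - 8 * (fls_X ^ 2 * (1 + fls_X + fls_X ^ 2) * mahler r\<^sub>0) - 4 * mahler r\<^sub>1"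
    and 2: "fls_X ^ 3 * r\<^sub>0 = 16 * mahler (mahler r\<^sub>0) - 4 * ((1 + fls_X + fls_X ^ 2) ^ 2 * mahler r\<^sub>0)
      - fls_X * (1 + fls_X + fls_X ^ 2) * r\<^sub>1 + fls_X ^ 3 + 2 * fls_X ^ 2"
  shows False
proof -
  define s where "s = mahler r\<^sub>0"
  have X: "(fls_X * f) $$ n = f $$ (n - 1)" "(fls_X ^ k * f) $$ n = f $$ (n - int k)"
    for f :: "complex fls" and n k
    by (simp_all add: fls_X_times_conv_shift fls_X_power_times_conv_shift)
  have "fls_X ^ 3 * r\<^sub>1 = 4 * fls_X ^ 4 - 8 * (fls_X ^ 2 * s + fls_X ^ 3 * s + fls_X ^ 4 * s) - 4 * mahler r\<^sub>1"
    unfolding 1 s_def by (simp add: algebra_simps power_numeral_reduce)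
  hence E1: "r\<^sub>1 $$ (n - 3) = (if n = 4 then 4 else 0) - 8 * (s $$ (n - 2) + s $$ (n - 3) + s $$ (n - 4))
      - 4 * mahler r\<^sub>1 $$ n" for n
    by (simp add: X fls_eq_iff)
  have "fls_X * r\<^sub>1 + fls_X ^ 2 * r\<^sub>1 + fls_X ^ 3 * r\<^sub>1 =
      16 * mahler s - 4 * (s + 2 * (fls_X * s) + 3 * (fls_X ^ 2 * s) + 2 * (fls_X ^ 3 * s) + fls_X ^ 4 * s)
      - fls_X ^ 3 * r\<^sub>0 + fls_X ^ 3 + 2 * fls_X ^ 2"
    using 2 unfolding s_def by (simp add: algebra_simps power_numeral_reduce)
  hence E2: "r\<^sub>1 $$ (n - 1) + r\<^sub>1 $$ (n - 2) + r\<^sub>1 $$ (n - 3) = 16 * mahler s $$ n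
      - 4 * (s $$ n + 2 * s $$ (n - 1) + 3 * s $$ (n - 2) + 2 * s $$ (n - 3) + s $$ (n - 4))
      - r\<^sub>0 $$ (n - 3) + (if n = 3 then 1 else 0) + (if n = 2 then 2 else 0)" for n
    by (simp add: X fls_eq_iff)
  have mahler_nth: "mahler f $$ n = (if 4 dvd n then f $$ (n div 4) else 0)" for f n
    by (simp add: fls_nth_compose_power)
  define e where "e = fls_subdegree r\<^sub>0"
  define e' where "e' = fls_subdegree r\<^sub>1"
  have r0_0: "r\<^sub>0 $$ n = 0" if "n < e" for n
    using that by (simp add: e_def)
  have r1_0: "r\<^sub>1 $$ n = 0" if "n < e'" for n
    using that by (simp add: e'_def)
  show False
  proof (cases "r\<^sub>0 = 0 \<or> e > 0")
    case True
    have r0: "r\<^sub>0 $$ n = 0" if "n \<le> 0" for n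
      using True that r0_0[of n] by auto
    have s: "s $$ n = 0" if "n < 4" for n
    proof -
      have "n div 4 \<le> 0"
        using that by linarith
      thus ?thesis
        by (simp add: s_def mahler_nth r0)
    qed
    have ms: "mahler s $$ n = 0" if "n < 4" for n
    proof -
      have "n div 4 < 4"
        using that by linarith
      thus ?thesis
        by (simp add: mahler_nth s)
    qed
    have r1: "r\<^sub>1 $$ n = 0" if "n \<le> 0" for n
    proof (rule ccontr)
      assume "r\<^sub>1 $$ n \<noteq> 0"
      hence "e' \<le> n"
        using r1_0[of n] by force
      have "r\<^sub>1 $$ e' \<noteq> 0"
        using \<open>r\<^sub>1 $$ n \<noteq> 0\<close> unfolding e'_def nth_fls_subdegree_zero_iff by auto
      thus False
        using E2[of "e' + 1"] r1_0[of "e' - 1"] r1_0[of "e' - 2"] \<open>e' \<le> n\<close> \<open>n \<le> 0\<close>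
        by (simp add: s ms r0)
    qed
    have "r\<^sub>1 $$ 1 = 2"
      using E2[of 2] by (simp add: s ms r0 r1)
    thus False
      using E1[of 4] by (simp add: s mahler_nth)
  next
    case False
    hence "e \<le> 0" "r\<^sub>0 $$ e \<noteq> 0"
      by (auto simp: e_def)
    have s: "s $$ n = 0" if "n < 4 * e" for n
    proof -
      have "n div 4 < e"
        using that by linarith
      thus ?thesis
        by (simp add: s_def mahler_nth r0_0)
    qed
    have ms: "mahler s $$ n = 0" if "n < 16 * e" for n
    proof -
      have "n div 4 < 4 * e"
        using that by linarith
      thus ?thesis
        by (simp add: mahler_nth s)
    qed
    have "mahler s $$ (16 * e) = r\<^sub>0 $$ e"
    proof -
      have "16 * e = 4 * (4 * e)"
        by simp
      thus ?thesis
        by (simp only: mahler_nth s_def) simp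
    qed
    \<comment> \<open>For \<open>e < 0\<close> the series \<open>s\<close> starts above degree
      \<open>16 * e\<close>; for \<open>e = 0\<close> the two terms combine to
      \<open>12 * r\<^sub>0 $$ 0\<close>.\<close>
    have "16 * mahler s $$ (16 * e) - 4 * s $$ (16 * e) \<noteq> 0"
    proof (cases "e = 0")
      case True
      thus ?thesis
        using \<open>mahler s $$ (16 * e) = r\<^sub>0 $$ e\<close> \<open>r\<^sub>0 $$ e \<noteq> 0\<close> by (simp add: s_def mahler_nth)
    next
      case False
      thus ?thesis
        using \<open>mahler s $$ (16 * e) = r\<^sub>0 $$ e\<close> \<open>r\<^sub>0 $$ e \<noteq> 0\<close> \<open>e \<le> 0\<close> by (simp add: s)
    qed
    hence top: "r\<^sub>1 $$ (16 * e - 1) + r\<^sub>1 $$ (16 * e - 2) + r\<^sub>1 $$ (16 * e - 3) \<noteq> 0"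
      using E2[of "16 * e"] \<open>e \<le> 0\<close> by (simp add: s r0_0)
    hence "r\<^sub>1 \<noteq> 0"
      by auto
    hence "r\<^sub>1 $$ e' \<noteq> 0"
      by (auto simp: e'_def)
    have "e' \<le> 16 * e - 1"
      using top r1_0 by (smt (verit, best) add.right_neutral)
    have "e' = 16 * e - 1"
    proof (rule ccontr)
      assume "e' \<noteq> 16 * e - 1"
      hence "e' + 1 < 16 * e"
        using \<open>e' \<le> 16 * e - 1\<close> by simp
      thus False
        using E2[of "e' + 1"] \<open>r\<^sub>1 $$ e' \<noteq> 0\<close> \<open>e \<le> 0\<close> by (simp add: s ms r0_0 r1_0)
    qed
    \<comment> \<open>All other terms of \<open>E1\<close> vanish in this degree:
      \<open>4 * e' - 3 < e'\<close> because \<open>e'\<close> is negative, and \<open>s\<close> has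
      no terms below degree \<open>4 * e\<close>.\<close>
    have "mahler r\<^sub>1 $$ (4 * e') = 0"
      using E1[of "4 * e'"] \<open>e' = 16 * e - 1\<close> \<open>e \<le> 0\<close> by (simp add: s r1_0)
    thus False
      using \<open>r\<^sub>1 $$ e' \<noteq> 0\<close> by (simp add: mahler_nth)
  qed
qed

text \<open>The hypotheses concern expansions at 0. For rational functions they amount to polynomial
  identities over a common denominator, which can be re-expanded at infinity.\<close>

lemma no_rational_solution:
  assumes r: "r\<^sub>0 \<in> complex_rational_functions" "r\<^sub>1 \<in> complex_rational_functions"
    and 1: "fls_X * r\<^sub>1 = 4 * (1 - 2 * mahler_p * mahler r\<^sub>0 - fls_X ^ 4 * mahler r\<^sub>1)"
    and 2: "fls_X * r\<^sub>0 = 16 * fls_X ^ 4 * mahler (mahler r\<^sub>0) - 4 * mahler_p ^ 2 * mahler r\<^sub>0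
      - fls_X * mahler_p * r\<^sub>1 + fls_X * (1 + 2 * fls_X)"
  shows False
proof -
  obtain A\<^sub>0 Q\<^sub>0 where Q\<^sub>0: "Q\<^sub>0 \<noteq> 0" "r\<^sub>0 = fls_of_poly A\<^sub>0 / fls_of_poly Q\<^sub>0"
    using r(1) by (rule complex_rational_functionsE)
  obtain A\<^sub>1 Q\<^sub>1 where Q\<^sub>1: "Q\<^sub>1 \<noteq> 0" "r\<^sub>1 = fls_of_poly A\<^sub>1 / fls_of_poly Q\<^sub>1"
    using r(2) by (rule complex_rational_functionsE)
  define A B Q where "A = A\<^sub>0 * Q\<^sub>1" and "B = A\<^sub>1 * Q\<^sub>0" and "Q = Q\<^sub>0 * Q\<^sub>1"
  let ?X = "[:0, 1 :: complex:]" and ?p = "[:1, 1, 1 :: complex:]"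
  let ?\<sigma> = "\<lambda>f :: complex poly. subst_pow4 f"
  have "Q \<noteq> 0"
    using Q\<^sub>0 Q\<^sub>1 by (simp add: Q_def)
  have \<sigma>_neq_0: "?\<sigma> f \<noteq> 0" if "f \<noteq> 0" for f
    using that by (simp add: pcompose_eq_0_iff degree_monom_eq)
  have AB: "r\<^sub>0 = fls_of_poly A / fls_of_poly Q" "r\<^sub>1 = fls_of_poly B / fls_of_poly Q"
    using Q\<^sub>0 Q\<^sub>1 by (simp_all add: A_def B_def Q_def)
  have \<sigma>_r: "mahler r\<^sub>0 = fls_of_poly (?\<sigma> A) / fls_of_poly (?\<sigma> Q)"
    "mahler r\<^sub>1 = fls_of_poly (?\<sigma> B) / fls_of_poly (?\<sigma> Q)"
    "mahler (mahler r\<^sub>0) = fls_of_poly (?\<sigma> (?\<sigma> A)) / fls_of_poly (?\<sigma> (?\<sigma> Q))"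
    unfolding AB rat.hom_divide fls_of_poly_subst_pow4 by (rule refl)+
  have neq: "fls_of_poly Q \<noteq> 0" "fls_of_poly (?\<sigma> Q) \<noteq> 0" "fls_of_poly (?\<sigma> (?\<sigma> Q)) \<noteq> 0"
    using \<open>Q \<noteq> 0\<close> \<sigma>_neq_0 by simp_all
  have "fls_of_poly (?X * B * ?\<sigma> Q) =
      fls_of_poly (4 * Q * (?\<sigma> Q - 2 * ?p * ?\<sigma> A - ?X ^ 4 * ?\<sigma> B))"
  proof -
    have "fls_of_poly (?X * B * ?\<sigma> Q) = (fls_X * r\<^sub>1) * (fls_of_poly Q * fls_of_poly (?\<sigma> Q))"
      unfolding fls_of_poly.hom_mult fls_of_poly_X AB using neq by simp
    also have "\<dots> = fls_of_poly (4 * Q * (?\<sigma> Q - 2 * ?p * ?\<sigma> A - ?X ^ 4 * ?\<sigma> B))"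
      unfolding 1 \<sigma>_r fls_of_poly.hom_mult fls_of_poly.hom_diff fls_of_poly.hom_numeral
        fls_of_poly.hom_power fls_of_poly_X fls_of_poly_p
      using neq by (simp add: field_simps)
    finally show ?thesis .
  qed
  hence 1: "?X * B * ?\<sigma> Q = 4 * Q * (?\<sigma> Q - 2 * ?p * ?\<sigma> A - ?X ^ 4 * ?\<sigma> B)"
    by (simp only: fls_of_poly_eq_iff)
  have "fls_of_poly (?X * A * ?\<sigma> Q * ?\<sigma> (?\<sigma> Q)) =
      fls_of_poly (16 * ?X ^ 4 * ?\<sigma> (?\<sigma> A) * Q * ?\<sigma> Q - 4 * ?p ^ 2 * ?\<sigma> A * Q * ?\<sigma> (?\<sigma> Q)
        - ?X * ?p * B * ?\<sigma> Q * ?\<sigma> (?\<sigma> Q) + ?X * (1 + 2 * ?X) * Q * ?\<sigma> Q * ?\<sigma> (?\<sigma> Q))"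
  proof -
    have "fls_of_poly (?X * A * ?\<sigma> Q * ?\<sigma> (?\<sigma> Q)) =
        (fls_X * r\<^sub>0) * (fls_of_poly Q * fls_of_poly (?\<sigma> Q) * fls_of_poly (?\<sigma> (?\<sigma> Q)))"
      unfolding fls_of_poly.hom_mult fls_of_poly_X AB using neq by simp
    also have "\<dots> = fls_of_poly (16 * ?X ^ 4 * ?\<sigma> (?\<sigma> A) * Q * ?\<sigma> Q - 4 * ?p ^ 2 * ?\<sigma> A * Q * ?\<sigma> (?\<sigma> Q)
        - ?X * ?p * B * ?\<sigma> Q * ?\<sigma> (?\<sigma> Q) + ?X * (1 + 2 * ?X) * Q * ?\<sigma> Q * ?\<sigma> (?\<sigma> Q))"
      unfolding 2 \<sigma>_r(3) unfolding \<sigma>_r(1,2) AB(2) fls_of_poly.hom_mult fls_of_poly.hom_diff fls_of_poly.hom_numeral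
        fls_of_poly.hom_power fls_of_poly_X fls_of_poly_p fls_of_poly.hom_add fls_of_poly.hom_1
      using neq by (simp add: field_simps)
    finally show ?thesis .
  qed
  hence 2: "?X * A * ?\<sigma> Q * ?\<sigma> (?\<sigma> Q) =
      16 * ?X ^ 4 * ?\<sigma> (?\<sigma> A) * Q * ?\<sigma> Q - 4 * ?p ^ 2 * ?\<sigma> A * Q * ?\<sigma> (?\<sigma> Q)
        - ?X * ?p * B * ?\<sigma> Q * ?\<sigma> (?\<sigma> Q) + ?X * (1 + 2 * ?X) * Q * ?\<sigma> Q * ?\<sigma> (?\<sigma> Q)"
    by (simp only: fls_of_poly_eq_iff)
  let ?\<eta> = fls_at_infinity
  define x where "x = (fls_X :: complex fls)"
  have "x \<noteq> 0"
    by (simp add: x_def)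
  let ?t = "1 + x + x ^ 2"
  have X_inv: "fls_X_inv = 1 / x"
    unfolding x_def by (metis fls_inverse_X inverse_eq_divide)
  have "?\<eta> ?X = fls_X_inv" "?\<eta> ?p = 1 + fls_X_inv + fls_X_inv ^ 2"
    by (simp_all add: fls_at_infinity_pCons power2_eq_square algebra_simps)
  hence \<eta>_X: "?\<eta> ?X = 1 / x" and "?\<eta> ?p = 1 + 1 / x + (1 / x) ^ 2"
    unfolding X_inv .
  hence \<eta>_p: "?\<eta> ?p = ?t / x ^ 2"
    using \<open>x \<noteq> 0\<close> by (simp add: field_simps power2_eq_square)
  define R\<^sub>0 R\<^sub>1 where "R\<^sub>0 = ?\<eta> A / ?\<eta> Q" and "R\<^sub>1 = ?\<eta> B / ?\<eta> Q"
  have neq: "?\<eta> Q \<noteq> 0" "?\<eta> (?\<sigma> Q) \<noteq> 0" "?\<eta> (?\<sigma> (?\<sigma> Q)) \<noteq> 0"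
    using \<open>Q \<noteq> 0\<close> \<sigma>_neq_0 fls_at_infinity_neq_0 by simp_all
  have \<sigma>_R: "mahler R\<^sub>0 = ?\<eta> (?\<sigma> A) / ?\<eta> (?\<sigma> Q)" "mahler R\<^sub>1 = ?\<eta> (?\<sigma> B) / ?\<eta> (?\<sigma> Q)"
    "mahler (mahler R\<^sub>0) = ?\<eta> (?\<sigma> (?\<sigma> A)) / ?\<eta> (?\<sigma> (?\<sigma> Q))"
    unfolding R\<^sub>0_def R\<^sub>1_def rat.hom_divide fls_at_infinity_subst_pow4 by (rule refl)+
  have "1 / x * R\<^sub>1 = 4 * (1 - 2 * (?t / x ^ 2) * mahler R\<^sub>0 - (1 / x) ^ 4 * mahler R\<^sub>1)"
  proof -
    have "1 / x * R\<^sub>1 = ?\<eta> (?X * B * ?\<sigma> Q) / (?\<eta> Q * ?\<eta> (?\<sigma> Q))"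
      unfolding fls_at_infinity.hom_mult \<eta>_X R\<^sub>1_def using neq by simp
    also have "\<dots> = 4 * (1 - 2 * (?t / x ^ 2) * mahler R\<^sub>0 - (1 / x) ^ 4 * mahler R\<^sub>1)"
      unfolding 1 \<sigma>_R fls_at_infinity.hom_mult fls_at_infinity.hom_diff fls_at_infinity.hom_numeral
        fls_at_infinity.hom_power \<eta>_X \<eta>_p
      using neq \<open>x \<noteq> 0\<close> by (simp add: divide_simps)
    finally show ?thesis .
  qed
  \<comment> \<open>The factor \<open>x ^ 4\<close> clears the negative powers of \<open>x\<close>
    and produces the form treated in \<open>no_solution_at_infinity\<close>.\<close>
  hence "x ^ 4 * (1 / x * R\<^sub>1) =
      x ^ 4 * (4 * (1 - 2 * (?t / x ^ 2) * mahler R\<^sub>0 - (1 / x) ^ 4 * mahler R\<^sub>1))"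
    by (rule arg_cong)
  also have "x ^ 4 * (1 / x * R\<^sub>1) = x ^ 3 * R\<^sub>1"
    using \<open>x \<noteq> 0\<close> by (simp add: power_numeral_reduce)
  also have "x ^ 4 * (4 * (1 - 2 * (?t / x ^ 2) * mahler R\<^sub>0 - (1 / x) ^ 4 * mahler R\<^sub>1)) =
      4 * x ^ 4 - 8 * (x ^ 2 * ?t * mahler R\<^sub>0) - 4 * mahler R\<^sub>1"
    using \<open>x \<noteq> 0\<close> by (simp add: power_numeral_reduce field_simps)
  finally have E1: "x ^ 3 * R\<^sub>1 = 4 * x ^ 4 - 8 * (x ^ 2 * ?t * mahler R\<^sub>0) - 4 * mahler R\<^sub>1" .
  have "1 / x * R\<^sub>0 = 16 * (1 / x) ^ 4 * mahler (mahler R\<^sub>0) - 4 * (?t / x ^ 2) ^ 2 * mahler R\<^sub>0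
      - 1 / x * (?t / x ^ 2) * R\<^sub>1 + 1 / x * (1 + 2 * (1 / x))"
  proof -
    have "1 / x * R\<^sub>0 = ?\<eta> (?X * A * ?\<sigma> Q * ?\<sigma> (?\<sigma> Q)) / (?\<eta> Q * ?\<eta> (?\<sigma> Q) * ?\<eta> (?\<sigma> (?\<sigma> Q)))"
      unfolding fls_at_infinity.hom_mult \<eta>_X R\<^sub>0_def using neq by simp
    also have "\<dots> = 16 * (1 / x) ^ 4 * mahler (mahler R\<^sub>0) - 4 * (?t / x ^ 2) ^ 2 * mahler R\<^sub>0
      - 1 / x * (?t / x ^ 2) * R\<^sub>1 + 1 / x * (1 + 2 * (1 / x))"
      unfolding 2 \<sigma>_R(3) unfolding \<sigma>_R(1,2) R\<^sub>1_def fls_at_infinity.hom_mult fls_at_infinity.hom_diff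
        fls_at_infinity.hom_numeral fls_at_infinity.hom_power fls_at_infinity.hom_add
        fls_at_infinity.hom_1 \<eta>_X \<eta>_p add_divide_distrib diff_divide_distrib
      using neq by simp
    finally show ?thesis .
  qed
  hence "x ^ 4 * (1 / x * R\<^sub>0) = x ^ 4 * (16 * (1 / x) ^ 4 * mahler (mahler R\<^sub>0)
      - 4 * (?t / x ^ 2) ^ 2 * mahler R\<^sub>0
      - 1 / x * (?t / x ^ 2) * R\<^sub>1 + 1 / x * (1 + 2 * (1 / x)))"
    by (rule arg_cong)
  also have "x ^ 4 * (1 / x * R\<^sub>0) = x ^ 3 * R\<^sub>0"
    using \<open>x \<noteq> 0\<close> by (simp add: power_numeral_reduce)
  also have "x ^ 4 * (16 * (1 / x) ^ 4 * mahler (mahler R\<^sub>0) - 4 * (?t / x ^ 2) ^ 2 * mahler R\<^sub>0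
      - 1 / x * (?t / x ^ 2) * R\<^sub>1 + 1 / x * (1 + 2 * (1 / x))) =
      16 * mahler (mahler R\<^sub>0) - 4 * (?t ^ 2 * mahler R\<^sub>0) - x * ?t * R\<^sub>1 + x ^ 3 + 2 * x ^ 2"
    using \<open>x \<noteq> 0\<close> by (simp add: power_numeral_reduce field_simps)
  finally have E2: "x ^ 3 * R\<^sub>0 = 16 * mahler (mahler R\<^sub>0) - 4 * (?t ^ 2 * mahler R\<^sub>0)
      - x * ?t * R\<^sub>1 + x ^ 3 + 2 * x ^ 2" .
  show False
    by (rule no_solution_at_infinity[OF E1[unfolded x_def] E2[unfolded x_def]])
qed

section \<open>The tower of extensions\<close>

lemma fls_deriv_mahler: "fls_deriv (mahler f) = 4 * fls_X ^ 3 * mahler (fls_deriv f)"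
proof (rule fls_eqI)
  fix n
  have "(4 * fls_X ^ 3 * mahler (fls_deriv f)) $$ n = (4 * (fls_X ^ 3 * mahler (fls_deriv f))) $$ n"
    by (simp only: mult.assoc)
  also have "\<dots> = 4 * (fls_X ^ 3 * mahler (fls_deriv f)) $$ n"
    by (rule fls_mult_of_numeral_nth)
  also have "\<dots> = 4 * mahler (fls_deriv f) $$ (n - 3)"
    by (subst fls_X_power_times_conv_shift(1)) simp
  also have "\<dots> = fls_deriv (mahler f) $$ n"
  proof (cases "4 dvd n + 1")
    case True
    then obtain k where k: "n + 1 = 4 * k" ..
    hence "4 dvd n - 3" "(n - 3) div 4 = k - 1" "(n + 1) div 4 = k"
      by presburger+
    thus ?thesis
      using k by (simp add: fls_nth_compose_power flip: of_int_mult) simp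
  next
    case False
    hence "\<not> 4 dvd n - 3"
      by presburger
    thus ?thesis
      using False by (simp add: fls_nth_compose_power)
  qed
  finally show "fls_deriv (mahler f) $$ n = (4 * fls_X ^ 3 * mahler (fls_deriv f)) $$ n" ..
qed

locale mahler_solution =
  fixes a :: "complex fls"
  assumes a_neq_0: "a \<noteq> 0"
    and a_eq: "a = mahler_p * mahler a - fls_X ^ 4 * mahler (mahler a)"
begin

abbreviation (input) K where "K \<equiv> complex_rational_functions"

definition z :: "complex fls" where "z = fls_X"

lemma z_neq_0 [simp]: "z \<noteq> 0"
  by (simp add: z_def)

lemma z_in_K [simp, intro]: "z \<in> K"
  by (simp add: z_def)

lemma mahler_z: "mahler z = z ^ 4"
  by (simp add: z_def mahler_X)

lemma fls_deriv_mahler_z: "fls_deriv (mahler f) = 4 * z ^ 3 * mahler (fls_deriv f)"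
  by (simp only: z_def fls_deriv_mahler)

definition u where "u = a / mahler a"

definition w where "w = fls_deriv u"

definition l where "l = fls_deriv a / a"

lemma u_neq_0: "u \<noteq> 0"
  using a_neq_0 by (simp add: u_def)

lemma a_eq_u: "a = u * mahler a"
  using a_neq_0 by (simp add: u_def)

lemma u_eq: "u = mahler_p - z ^ 4 / mahler u"
proof -
  have "u = (mahler_p * mahler a - z ^ 4 * mahler (mahler a)) / mahler a"
    unfolding u_def z_def by (subst (1) a_eq) (rule refl)
  also have "\<dots> = mahler_p - z ^ 4 / (mahler a / mahler (mahler a))"
    using a_neq_0 by (simp add: diff_divide_distrib)
  also have "mahler a / mahler (mahler a) = mahler u"
    by (simp add: u_def)
  finally show ?thesis .
qed

sublocale M: mobius_equation K mahler "z ^ 4" mahler_p u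
  using u_eq u_neq_0 no_rational_mobius_eigenvector[folded z_def] by unfold_locales auto

section \<open>Transcendence of the derivative \<open>w\<close>\<close>

definition L1 where "L1 = adjoin K u"

sublocale L1: stable_subfield L1 mahler
proof -
  interpret Ku: subfield_of "adjoin K u"
    by (rule rat.subfield_of_adjoin)
  have "mahler u \<in> adjoin K u"
    unfolding M.s_u
    by (intro Ku.divide_closed Ku.diff_closed rat.in_adjoin rat.subset_adjoin[of mahler_p]
        rat.subset_adjoin[of "z ^ 4"]) auto
  thus "stable_subfield L1 mahler"
    unfolding L1_def by (rule rat.stable_subfield_adjoin)
qed

lemma K_L1: "x \<in> K \<Longrightarrow> x \<in> L1"
  unfolding L1_def by (rule rat.subset_adjoin)

lemma L1_closed [simp, intro]: "u \<in> L1" "z \<in> L1" "mahler_p \<in> L1"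
  unfolding L1_def by (auto intro: rat.in_adjoin rat.subset_adjoin)

lemma p_minus_u_times: "(mahler_p - u) * mahler u = z ^ 4"
  using u_neq_0 by (simp add: M.p_minus_u)

lemma z_power_deriv: "fls_deriv (z ^ 4) = 4 * z ^ 3"
  by (simp add: z_def fls_deriv_power)

text \<open>Differentiate \<open>p_minus_u_times\<close> and multiply by
  \<open>mahler_p - u\<close>, so that the same relation eliminates \<open>mahler u\<close>.\<close>

lemma w_eq: "w = 4 / z * (mahler_p - u) ^ 2 * mahler w + (1 + 2 * z - 4 / z * (mahler_p - u))"
proof -
  have "fls_deriv mahler_p = 1 + 2 * z"
    by (simp add: mahler_p_def z_def fls_deriv_power)
  hence "(1 + 2 * z - w) * mahler u + (mahler_p - u) * (4 * z ^ 3 * mahler w) = 4 * z ^ 3"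
    using arg_cong[OF p_minus_u_times, of fls_deriv]
    by (simp add: fls_deriv_mahler_z z_power_deriv w_def algebra_simps)
  hence "(mahler_p - u) * ((1 + 2 * z - w) * mahler u + (mahler_p - u) * (4 * z ^ 3 * mahler w)) =
      (mahler_p - u) * (4 * z ^ 3)"
    by simp
  also have "(mahler_p - u) * ((1 + 2 * z - w) * mahler u + (mahler_p - u) * (4 * z ^ 3 * mahler w)) =
      (1 + 2 * z - w) * ((mahler_p - u) * mahler u) + (mahler_p - u) ^ 2 * (4 * z ^ 3 * mahler w)"
    by (simp add: algebra_simps power2_eq_square)
  also have "\<dots> = z ^ 3 * ((1 + 2 * z - w) * z + 4 * (mahler_p - u) ^ 2 * mahler w)"
    unfolding p_minus_u_times by (simp add: algebra_simps power_numeral_reduce)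
  also have "(mahler_p - u) * (4 * z ^ 3) = z ^ 3 * (4 * (mahler_p - u))"
    by simp
  finally have "(1 + 2 * z - w) * z + 4 * (mahler_p - u) ^ 2 * mahler w = 4 * (mahler_p - u)"
    by simp
  hence *: "w * z = 4 * (mahler_p - u) ^ 2 * mahler w + (1 + 2 * z) * z - 4 * (mahler_p - u)"
    by (simp add: algebra_simps)
  have "w = w * z / z"
    by simp
  also have "\<dots> = 4 / z * (mahler_p - u) ^ 2 * mahler w + (1 + 2 * z - 4 / z * (mahler_p - u))"
    unfolding * by (simp add: add_divide_distrib diff_divide_distrib)
  finally show ?thesis .
qed

text \<open>\<open>M.adjoin_solution\<close> with exponents 2 and 0 leaves a polynomial of degree at
  most 2 in \<open>u\<close>. Its coefficients satisfy three equations; eliminating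
  \<open>f2\<close> leaves the system for \<open>f0\<close> and \<open>f1\<close> of
  \<open>no_rational_solution\<close>.\<close>

lemma w_no_solution:
  assumes "r \<in> L1"
  shows "r \<noteq> 4 / z * (mahler_p - u) ^ 2 * mahler r + (1 + 2 * z - 4 / z * (mahler_p - u))"
proof
  assume eq: "r = 4 / z * (mahler_p - u) ^ 2 * mahler r + (1 + 2 * z - 4 / z * (mahler_p - u))"
  define p where "p = mahler_p"
  define y where "y = 4 / z"
  have K: "p \<in> K" "y \<in> K" "y \<noteq> 0"
    by (auto simp: p_def y_def)
  define h where "h = [:1 + 2 * z - y * p, y:]"
  have h: "h \<in> polys_over K"
    using K by (auto simp: h_def)
  have hu: "poly h u = 1 + 2 * z - y * (p - u)"
    by (simp add: h_def algebra_simps)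
  have "h \<noteq> 0"
    using K by (simp add: h_def)
  hence "poly h u \<noteq> 0"
    using M.transcendental h unfolding transcendental_over_def by blast
  hence "r \<noteq> 0"
    using eq hu by (auto simp: y_def p_def)
  obtain f where f: "f \<in> polys_over K" "r = poly f u" "int (degree f) \<le> 2 + int 0"
  proof (rule M.adjoin_solution[of r y 2 h 0])
    show "r = y * (mahler_p - u) powi 2 * mahler r + poly h u / (mahler_p - u) ^ 0"
      using eq unfolding hu by (simp add: y_def p_def)
  qed (use assms K h \<open>r \<noteq> 0\<close> in \<open>auto simp: L1_def\<close>)
  define f0 f1 f2 where "f0 = coeff f 0" and "f1 = coeff f 1" and "f2 = coeff f 2"
  have f_eq: "f = [:f0, f1, f2:]"
  proof (rule poly_eqI)
    fix n
    show "coeff f n = coeff [:f0, f1, f2:] n"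
      using f(3) by (cases "n \<le> 2")
        (auto simp: coeff_eq_0 f0_def f1_def f2_def numeral_2_eq_2 le_Suc_eq coeff_pCons split: nat.split)
  qed
  have fK: "f0 \<in> K" "f1 \<in> K" "f2 \<in> K"
    using f(1) by (auto simp: f0_def f1_def f2_def polys_over_def)
  define g where "g = [:y * (p ^ 2 * mahler f0 + z ^ 4 * p * mahler f1 + (z ^ 4) ^ 2 * mahler f2),
    y * (- 2 * p * mahler f0 - z ^ 4 * mahler f1), y * mahler f0:] + h"
  have "f = g"
  proof (rule rat.transcendental_over_eqI[OF M.transcendental f(1)])
    \<comment> \<open>Each factor \<open>mahler u\<close> in \<open>mahler r\<close> is absorbed by
      a factor \<open>p - u\<close>, so \<open>(p - u) ^ 2 * mahler r\<close> is a polynomial in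
      \<open>u\<close>.\<close>
    have z4: "(p - u) * mahler u = z ^ 4"
      using p_minus_u_times by (simp add: p_def)
    have "mahler r = mahler f0 + mahler u * (mahler f1 + mahler u * mahler f2)"
      unfolding f(2) f_eq by simp
    hence "(p - u) ^ 2 * mahler r = mahler f0 * (p - u) ^ 2 + mahler f1 * ((p - u) * mahler u) * (p - u)
        + mahler f2 * ((p - u) * mahler u) ^ 2"
      by (simp add: algebra_simps power2_eq_square)
    hence *: "(p - u) ^ 2 * mahler r = mahler f0 * (p - u) ^ 2 + mahler f1 * z ^ 4 * (p - u)
        + mahler f2 * (z ^ 4) ^ 2"
      unfolding z4 .
    have "poly f u = y * ((p - u) ^ 2 * mahler r) + poly h u"
      using eq unfolding hu f(2)[symmetric] by (simp add: y_def p_def mult.assoc)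
    thus "poly f u = poly g u"
      unfolding * g_def by (simp add: algebra_simps power2_eq_square)
    show "g \<in> polys_over K"
      using h K fK by (auto simp: g_def)
  qed
  hence c0: "f0 = y * (p ^ 2 * mahler f0 + z ^ 4 * p * mahler f1 + (z ^ 4) ^ 2 * mahler f2) + (1 + 2 * z - y * p)"
    and c1: "f1 = y * (- 2 * p * mahler f0 - z ^ 4 * mahler f1) + y"
    and c2: "f2 = y * mahler f0"
    unfolding f_eq g_def h_def add_pCons add_0_right pCons_eq_iff by blast+
  have zy: "z * y = 4"
    by (simp add: y_def)
  have "z * f1 = (z * y) * (- 2 * p * mahler f0 - z ^ 4 * mahler f1) + z * y"
    by (subst c1) (simp add: algebra_simps)
  hence 1: "z * f1 = 4 * (1 - 2 * p * mahler f0 - z ^ 4 * mahler f1)"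
    unfolding zy by (simp add: algebra_simps)
  have "z ^ 4 * mahler f2 = (z ^ 4 * mahler y) * mahler (mahler f0)"
    by (simp add: c2)
  also have "z ^ 4 * mahler y = mahler (z * y)"
    by (simp only: fls_compose_power_mult mahler_z)
  also have "\<dots> = 4"
    by (simp only: zy rat.hom_numeral)
  finally have "z ^ 4 * mahler f2 = 4 * mahler (mahler f0)" .
  moreover have "(z ^ 4) ^ 2 * mahler f2 = z ^ 4 * (z ^ 4 * mahler f2)"
    by (simp only: power2_eq_square mult.assoc)
  ultimately have "(z ^ 4) ^ 2 * mahler f2 = 4 * z ^ 4 * mahler (mahler f0)"
    by simp
  moreover have "z * f0 = (z * y) * (p ^ 2 * mahler f0 + z ^ 4 * p * mahler f1 + (z ^ 4) ^ 2 * mahler f2)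
      + z * (1 + 2 * z) - (z * y) * p"
    by (subst c0) (simp add: algebra_simps)
  ultimately have "z * f0 = 4 * p ^ 2 * mahler f0 + p * (4 * z ^ 4 * mahler f1)
      + 16 * z ^ 4 * mahler (mahler f0) + z * (1 + 2 * z) - 4 * p"
    unfolding zy by (simp add: algebra_simps)
  \<comment> \<open>Eliminating \<open>mahler f1\<close> by the first equation also cancels the term
    \<open>- 4 * p\<close>.\<close>
  moreover have "4 * z ^ 4 * mahler f1 = 4 - 8 * p * mahler f0 - z * f1"
    using 1 by (simp add: algebra_simps)
  ultimately have "z * f0 = 16 * z ^ 4 * mahler (mahler f0) - 4 * p ^ 2 * mahler f0 - z * p * f1 + z * (1 + 2 * z)"
    by (simp only:) (simp add: algebra_simps power2_eq_square)
  thus False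
    using no_rational_solution[OF fK(1,2), folded z_def] 1 by (simp add: p_def)
qed

sublocale W: affine_equation L1 mahler "4 / z * (mahler_p - u) ^ 2"
    "1 + 2 * z - 4 / z * (mahler_p - u)" w
proof
  show "4 / z * (mahler_p - u) ^ 2 \<noteq> 0"
    using M.p_minus_u_neq_0 by simp
  show "w = 4 / z * (mahler_p - u) ^ 2 * mahler w + (1 + 2 * z - 4 / z * (mahler_p - u))"
    by (rule w_eq)
  show "r \<noteq> 4 / z * (mahler_p - u) ^ 2 * mahler r + (1 + 2 * z - 4 / z * (mahler_p - u))"
    if "r \<in> L1" for r
    using that by (rule w_no_solution)
qed auto

section \<open>Transcendence of the logarithmic derivative \<open>l\<close>\<close>

definition L2 where "L2 = adjoin L1 w"

sublocale L2: stable_subfield L2 mahler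
proof -
  \<comment> \<open>The twist of \<open>X\<close> expresses \<open>mahler w\<close> as a linear
    polynomial in \<open>w\<close> over \<open>L1\<close>.\<close>
  have "mahler w = poly (W.twist [:0, 1:]) w"
    by (subst W.poly_twist) simp
  also have "\<dots> \<in> adjoin L1 w"
    by (intro L1.poly_in_adjoin W.twist_closed) auto
  finally show "stable_subfield L2 mahler"
    unfolding L2_def by (rule L1.stable_subfield_adjoin)
qed

lemma L2_closed [simp, intro]: "x \<in> L1 \<Longrightarrow> x \<in> L2" "w \<in> L2"
  unfolding L2_def by (auto intro: L1.subset_adjoin L1.in_adjoin)

lemma l_eq: "l = 4 * z ^ 3 * mahler l + w / u"
proof -
  have "fls_deriv a = w * mahler a + u * (4 * z ^ 3 * mahler (fls_deriv a))"
    by (subst (1) a_eq_u) (simp only: fls_deriv_mult fls_deriv_mahler_z w_def add.commute)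
  hence "l = (w * mahler a + u * (4 * z ^ 3 * mahler (fls_deriv a))) / (u * mahler a)"
    unfolding l_def a_eq_u[symmetric] by simp
  also have "\<dots> = 4 * z ^ 3 * mahler l + w / u"
    using u_neq_0 a_neq_0 by (simp add: l_def add_divide_distrib)
  finally show ?thesis .
qed

text \<open>A solution would be a polynomial in \<open>w\<close>, and one of its coefficients would
  yield a nonzero element of \<open>L1\<close> whose equation has a negative degree bound.\<close>

lemma l_no_solution:
  assumes "r \<in> L2"
  shows "r \<noteq> 4 * z ^ 3 * mahler r + w / u"
proof
  assume eq: "r = 4 * z ^ 3 * mahler r + w / u"
  define y where "y = mahler_p - u"
  have "y \<noteq> 0"
    using M.p_minus_u_neq_0 by (simp add: y_def)
  obtain f where f: "f \<in> polys_over L1" "f = smult (4 * z ^ 3) (W.twist f) + [:0, 1 / u:]"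
  proof (rule W.adjoin_affine_solution[of r "4 * z ^ 3" "[:0, 1 / u:]"])
    show "r = 4 * z ^ 3 * mahler r + poly [:0, 1 / u:] w"
      using eq by simp
  qed (use assms in \<open>auto simp: L2_def\<close>)
  \<comment> \<open>The inhomogeneous term \<open>w / u\<close> sits in degree 1, so lower
    coefficients are not considered: the equation for \<open>g\<close> is homogeneous if
    \<open>n \<ge> 2\<close> and contains \<open>1 / u\<close> if \<open>n = 1\<close>.\<close>
  define n where "n = max (degree f) 1"
  define g where "g = coeff f n"
  have g: "g \<in> L1"
    using f by (simp add: g_def polys_over_def)
  have "g = 4 * z ^ 3 * (mahler g / (4 / z * y ^ 2) ^ n) + coeff [:0, 1 / u:] n"
    using W.coeff_twist_top[of f n] arg_cong[OF f(2), of "\<lambda>f. coeff f n"]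
    by (simp only: g_def y_def n_def coeff_add coeff_smult max.cobounded1)
  moreover have "4 * z ^ 3 * (mahler g / (4 / z * y ^ 2) ^ n) =
      4 * z ^ 3 * (z / 4) ^ n * y powi (- 2 * int n) * mahler g"
  proof -
    have "4 * x ^ 3 * (m / (4 / x * y ^ 2) ^ n) = 4 * x ^ 3 * (x / 4) ^ n * y powi (- 2 * int n) * m"
      if "x \<noteq> 0" for x m :: "complex fls"
    proof -
      have "y powi (- 2 * int n) = inverse ((y ^ 2) ^ n)"
      proof -
        have "- 2 * int n = - int (2 * n)"
          by simp
        thus ?thesis
          by (simp only: power_int_minus power_int_of_nat power_mult)
      qed
      thus ?thesis
        using that \<open>y \<noteq> 0\<close> by (simp add: power_mult_distrib power_divide field_simps)
    qed
    thus ?thesis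
      by (metis z_neq_0)
  qed
  ultimately have g_eq: "g = 4 * z ^ 3 * (z / 4) ^ n * y powi (- 2 * int n) * mahler g + coeff [:0, 1 / u:] n"
    by simp
  show False
  proof (cases "n = 1")
    case False
    hence n: "n = degree f" "n \<ge> 2"
      by (auto simp: n_def)
    hence "g \<noteq> 0"
      by (auto simp: g_def)
    have "coeff [:0, 1 / u:] n = 0"
      using n by (simp add: coeff_eq_0)
    hence "g = 4 * z ^ 3 * (z / 4) ^ n * (mahler_p - u) powi (- 2 * int n) * mahler g
        + poly 0 u / (mahler_p - u) ^ 0"
      using g_eq by (simp add: y_def)
    then obtain f' :: "complex fls poly" where "int (degree f') \<le> - 2 * int n + int 0"
      by (rule M.adjoin_solution[rotated 2]) (use g \<open>g \<noteq> 0\<close> in \<open>auto simp: L1_def\<close>)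
    thus False
      using n by simp
  next
    case True
    \<comment> \<open>\<open>M.adjoin_solution\<close> admits an inhomogeneous term with poles only
      at \<open>u = mahler_p\<close>. Subtracting \<open>1 / u\<close> moves the pole from
      \<open>u = 0\<close> to that point, since
      \<open>z ^ 4 / mahler u = mahler_p - u\<close>.\<close>
    define g' where "g' = g - 1 / u"
    have "g = z ^ 4 * y powi (- 2) * mahler g + 1 / u"
      using g_eq True by (simp add: power_numeral_reduce)
    hence "g' = z ^ 4 * y powi (- 2) * mahler g"
      by (simp only: g'_def diff_eq_eq)
    also have "mahler g = mahler g' + 1 / mahler u"
      by (simp add: g'_def)
    also have "z ^ 4 * y powi (- 2) * (mahler g' + 1 / mahler u) =
        z ^ 4 * y powi (- 2) * mahler g' + y powi (- 2) * (z ^ 4 / mahler u)"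
      by (simp add: algebra_simps)
    also have "z ^ 4 / mahler u = y"
      by (simp add: y_def M.p_minus_u)
    also have "y powi (- 2) * y = 1 / y"
      using \<open>y \<noteq> 0\<close> by (simp add: power_int_minus field_simps power2_eq_square)
    finally have eq: "g' = z ^ 4 * (mahler_p - u) powi (- 2) * mahler g' + poly 1 u / (mahler_p - u) ^ 1"
      by (simp add: y_def)
    have "g' \<noteq> 0"
      using eq M.p_minus_u_neq_0 by auto
    have "g' \<in> L1"
      using g by (auto simp: g'_def)
    obtain f' :: "complex fls poly" where "int (degree f') \<le> - 2 + int 1"
      by (rule M.adjoin_solution[OF _ _ eq]) (use \<open>g' \<in> L1\<close> \<open>g' \<noteq> 0\<close> in \<open>auto simp: L1_def\<close>)
    thus False
      by simp
  qed
qed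

sublocale L: affine_equation L2 mahler "4 * z ^ 3" "w / u" l
proof
  show "l = 4 * z ^ 3 * mahler l + w / u"
    by (rule l_eq)
  show "r \<noteq> 4 * z ^ 3 * mahler r + w / u" if "r \<in> L2" for r
    using that by (rule l_no_solution)
qed auto

section \<open>Transcendence of \<open>a\<close>\<close>

definition L3 where "L3 = adjoin L2 l"

sublocale L3: stable_subfield L3 mahler
proof -
  have "mahler l = poly (L.twist [:0, 1:]) l"
    by (subst L.poly_twist) simp
  also have "\<dots> \<in> adjoin L2 l"
    by (intro L2.poly_in_adjoin L.twist_closed) auto
  finally show "stable_subfield L3 mahler"
    unfolding L3_def by (rule L2.stable_subfield_adjoin)
qed

lemma L3_closed [simp, intro]: "x \<in> L2 \<Longrightarrow> x \<in> L3" "l \<in> L3"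
  unfolding L3_def by (auto intro: L2.subset_adjoin L2.in_adjoin)

text \<open>Otherwise a nonzero solution of \<open>r = u ^ n * mahler r\<close> in \<open>L3\<close>
  would exist. The equation is linear with multiplier in \<open>L1\<close>, so the solution descends
  to \<open>L1\<close>.\<close>

lemma a_transcendental: "transcendental_over L3 a"
proof (rule ccontr)
  assume "\<not> transcendental_over L3 a"
  then obtain n r where n: "n > 0" and r: "r \<in> L3" "r \<noteq> 0" "r = u ^ n * mahler r"
    using L3.mult_eq_algebraic[OF a_eq_u a_neq_0] by auto
  have "r \<in> L2"
    using L.adjoin_linear_solution[of r "u ^ n"] r by (auto simp: L3_def)
  hence "r \<in> L1"
    using W.adjoin_linear_solution[of r "u ^ n"] r by (auto simp: L2_def)
  \<comment> \<open>Dividing by \<open>u ^ n\<close> changes the multiplier to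
    \<open>mahler u ^ n\<close>, a power of \<open>mahler_p - u\<close> up to a factor in
    \<open>K\<close>, as \<open>M.adjoin_solution\<close> requires. The resulting degree bound is
    \<open>- n\<close>.\<close>
  define q where "q = r / u ^ n"
  have q: "q \<in> L1" "q \<noteq> 0"
    using \<open>r \<in> L1\<close> r u_neq_0 by (auto simp: q_def)
  have "q = mahler r"
    using r(3) u_neq_0 by (simp add: q_def field_simps)
  also have "r = q * u ^ n"
    using u_neq_0 by (simp add: q_def)
  finally have "q = mahler u ^ n * mahler q"
    by (simp add: mult.commute)
  also have "mahler u ^ n = (z ^ 4) ^ n * (mahler_p - u) powi (- int n)"
    by (simp add: M.s_u power_int_minus divide_inverse power_mult_distrib power_inverse)
  finally have "q = (z ^ 4) ^ n * (mahler_p - u) powi (- int n) * mahler q + poly 0 u / (mahler_p - u) ^ 0"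
    by simp
  then obtain f :: "complex fls poly" where "int (degree f) \<le> - int n + int 0"
    by (rule M.adjoin_solution[rotated 2]) (use q in \<open>auto simp: L1_def\<close>)
  thus False
    using n by simp
qed

section \<open>From the tower to algebraic independence\<close>

lemma deriv_a_eq: "fls_deriv a = a * l"
  using a_neq_0 by (simp add: l_def)

lemma mahler_deriv_a_eq: "mahler (fls_deriv a) = a * (1 / (4 * z ^ 3 * u)) * (l - w / u)"
proof -
  have "l - w / u = 4 * z ^ 3 * mahler l"
    using l_eq by (simp only: diff_eq_eq)
  moreover have "mahler (fls_deriv a) = mahler a * mahler l"
    by (simp add: deriv_a_eq)
  moreover have "mahler a = a / u"
    using a_neq_0 by (simp add: u_def)
  ultimately show ?thesis
    by simp
qed

text \<open>In terms of \<open>a\<close>, \<open>l\<close>, \<open>w\<close> and \<open>u\<close>, a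
  monomial becomes \<open>a\<close> to its total degree times
  \<open>l ^ e\<^sub>2 * (l - w / u) ^ e\<^sub>3\<close> and a factor from \<open>L1\<close>.
  Coefficients in \<open>a\<close>, \<open>l\<close>, \<open>w\<close>, \<open>u\<close> are
  extracted in turn, which isolates a nonzero \<open>c\<close> of largest \<open>e\<^sub>3\<close>
  within one total degree.\<close>

lemma monomial_relation_trivial:
  fixes S :: "'i set" and c :: "'i \<Rightarrow> complex fls" and e\<^sub>0 e\<^sub>1 e\<^sub>2 e\<^sub>3 :: "'i \<Rightarrow> nat"
  assumes "finite S" and c: "\<And>i. i \<in> S \<Longrightarrow> c i \<in> K"
    and inj: "\<And>i j. i \<in> S \<Longrightarrow> j \<in> S \<Longrightarrow> e\<^sub>0 i = e\<^sub>0 j \<Longrightarrow> e\<^sub>1 i = e\<^sub>1 j \<Longrightarrow> e\<^sub>2 i = e\<^sub>2 j \<Longrightarrow>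
      e\<^sub>3 i = e\<^sub>3 j \<Longrightarrow> i = j"
    and eq: "(\<Sum>i\<in>S. c i * (a ^ e\<^sub>0 i * mahler a ^ e\<^sub>1 i * fls_deriv a ^ e\<^sub>2 i *
      mahler (fls_deriv a) ^ e\<^sub>3 i)) = 0"
    and "i \<in> S"
  shows "c i = 0"
proof -
  define e where "e j = e\<^sub>0 j + e\<^sub>1 j + e\<^sub>2 j + e\<^sub>3 j" for j
  define k where "k = 1 / (4 * z ^ 3 * u)"
  define d where "d j = c j * (1 / u) ^ e\<^sub>1 j * k ^ e\<^sub>3 j" for j
  have k: "k \<in> L1" "k \<noteq> 0"
    using u_neq_0 by (auto simp: k_def)
  have d: "d j \<in> L1" if "j \<in> S" for j
    using k K_L1[OF c[OF that]] by (auto simp: d_def)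

  define A where "A = {j \<in> S. e j = e i}"
  have "(\<Sum>j\<in>S. d j * l ^ e\<^sub>2 j * (l - w / u) ^ e\<^sub>3 j * a ^ e j) = 0"
  proof -
    have "mahler a = a * (1 / u)"
      using a_neq_0 by (simp add: u_def)
    hence "d j * l ^ e\<^sub>2 j * (l - w / u) ^ e\<^sub>3 j * a ^ e j =
        c j * (a ^ e\<^sub>0 j * mahler a ^ e\<^sub>1 j * fls_deriv a ^ e\<^sub>2 j * mahler (fls_deriv a) ^ e\<^sub>3 j)" for j
      unfolding mahler_deriv_a_eq unfolding deriv_a_eq k_def[symmetric]
      by (simp add: power_mult_distrib power_divide power_add d_def e_def ac_simps)
    thus ?thesis
      using eq by simp
  qed
  hence "(\<Sum>j\<in>A. d j * l ^ e\<^sub>2 j * (l - w / u) ^ e\<^sub>3 j) = 0"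
    unfolding A_def using d
    by (intro L3.transcendental_over_sum_eq_0[OF a_transcendental \<open>finite S\<close>]) auto

  moreover define I where "I = (SIGMA j:A. {..e\<^sub>3 j})"
  define b where "b jr = d (fst jr) * of_nat (e\<^sub>3 (fst jr) choose snd jr) * (- 1 / u) ^ (e\<^sub>3 (fst jr) - snd jr)"
    for jr
  have "finite A" "A \<subseteq> S" "i \<in> A"
    using \<open>finite S\<close> \<open>i \<in> S\<close> by (auto simp: A_def)
  hence "finite I"
    by (simp add: I_def)
  have b: "b jr \<in> L1" if "jr \<in> I" for jr
    using that d \<open>A \<subseteq> S\<close> by (auto simp: b_def I_def)
  have "(\<Sum>jr\<in>I. b jr * w ^ (e\<^sub>3 (fst jr) - snd jr) * l ^ (e\<^sub>2 (fst jr) + snd jr)) =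
      (\<Sum>j\<in>A. d j * l ^ e\<^sub>2 j * (l - w / u) ^ e\<^sub>3 j)"
  proof -
    have "(l - w / u) ^ n = (\<Sum>r\<le>n. of_nat (n choose r) * l ^ r * ((- 1 / u) ^ (n - r) * w ^ (n - r)))" for n
      using binomial_ring[of l "- 1 / u * w" n] by (simp only: power_mult_distrib) simp
    hence "(\<Sum>j\<in>A. d j * l ^ e\<^sub>2 j * (l - w / u) ^ e\<^sub>3 j) =
        (\<Sum>j\<in>A. \<Sum>r\<le>e\<^sub>3 j. b (j, r) * w ^ (e\<^sub>3 j - r) * l ^ (e\<^sub>2 j + r))"
      by (intro sum.cong refl) (simp add: b_def sum_distrib_left power_add ac_simps)
    also have "\<dots> = (\<Sum>jr\<in>I. b jr * w ^ (e\<^sub>3 (fst jr) - snd jr) * l ^ (e\<^sub>2 (fst jr) + snd jr))"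
      unfolding I_def using \<open>finite A\<close> by (subst sum.Sigma) (auto simp: split_def)
    finally show ?thesis ..
  qed
  ultimately have "(\<Sum>jr\<in>I. b jr * w ^ (e\<^sub>3 (fst jr) - snd jr) * l ^ (e\<^sub>2 (fst jr) + snd jr)) = 0"
    by simp
  hence l0: "(\<Sum>jr\<in>{jr \<in> I. e\<^sub>2 (fst jr) + snd jr = n}. b jr * w ^ (e\<^sub>3 (fst jr) - snd jr)) = 0" for n
    using b by (intro L2.transcendental_over_sum_eq_0[OF L.transcendental \<open>finite I\<close>]) auto
  have w0: "(\<Sum>jr\<in>{jr \<in> {jr \<in> I. e\<^sub>2 (fst jr) + snd jr = n}. e\<^sub>3 (fst jr) - snd jr = m}. b jr) = 0" for n m
    by (rule L1.transcendental_over_sum_eq_0[OF W.transcendental _ _ l0[of n]])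
       (use b \<open>finite I\<close> in auto)

  \<comment> \<open>In the coefficient of \<open>l ^ e\<^sub>2 j * w ^ e\<^sub>3 j\<close>, a
    binomial term with \<open>r > 0\<close> belongs to an index of larger \<open>e\<^sub>3\<close>,
    where \<open>c\<close> vanishes. Only indices with the same \<open>e\<^sub>2\<close> and
    \<open>e\<^sub>3\<close> as \<open>j\<close> remain, with \<open>r = 0\<close>.\<close>
  have top: "c j = 0" if "j \<in> A" and max: "\<And>j'. j' \<in> A \<Longrightarrow> c j' \<noteq> 0 \<Longrightarrow> e\<^sub>3 j' \<le> e\<^sub>3 j" for j
  proof -
    define B where "B = {j' \<in> A. e\<^sub>2 j' = e\<^sub>2 j \<and> e\<^sub>3 j' = e\<^sub>3 j}"
    have "finite B"
      using \<open>finite A\<close> by (simp add: B_def)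
    let ?C = "{jr \<in> {jr \<in> I. e\<^sub>2 (fst jr) + snd jr = e\<^sub>2 j}. e\<^sub>3 (fst jr) - snd jr = e\<^sub>3 j}"
    have "0 = (\<Sum>jr\<in>?C. b jr)"
      using w0[of "e\<^sub>2 j" "e\<^sub>3 j"] by simp
    also have "\<dots> = (\<Sum>jr\<in>(\<lambda>j'. (j', 0)) ` B. b jr)"
    proof (intro sum.mono_neutral_right ballI)
      show "finite ?C"
        using \<open>finite I\<close> by simp
      show "(\<lambda>j'. (j', 0)) ` B \<subseteq> ?C"
        by (auto simp: B_def I_def)
      fix jr assume jr: "jr \<in> ?C - (\<lambda>j'. (j', 0)) ` B"
      obtain j' r where jr_eq: "jr = (j', r)"
        by (cases jr)
      have *: "j' \<in> A" "r \<le> e\<^sub>3 j'" "e\<^sub>2 j' + r = e\<^sub>2 j" "e\<^sub>3 j' - r = e\<^sub>3 j"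
        using jr by (auto simp: jr_eq I_def)
      have "r \<noteq> 0"
        using jr * by (auto simp: jr_eq B_def)
      hence "e\<^sub>3 j' > e\<^sub>3 j"
        using * by linarith
      hence "c j' = 0"
        using max[OF *(1)] by force
      thus "b jr = 0"
        by (simp add: b_def d_def jr_eq)
    qed
    also have "\<dots> = (\<Sum>j'\<in>B. b (j', 0))"
      by (subst sum.reindex) (auto simp: inj_on_def)
    also have "\<dots> = (\<Sum>j'\<in>B. k ^ e\<^sub>3 j * (- 1 / u) ^ e\<^sub>3 j * (c j' * (1 / u) ^ e\<^sub>1 j'))"
      by (intro sum.cong refl) (auto simp: b_def d_def B_def)
    finally have "k ^ e\<^sub>3 j * (- 1 / u) ^ e\<^sub>3 j * (\<Sum>j'\<in>B. c j' * (1 / u) ^ e\<^sub>1 j') = 0"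
      by (simp only: sum_distrib_left)
    hence "(\<Sum>j'\<in>B. c j' * (1 / u) ^ e\<^sub>1 j') = 0"
      using k u_neq_0 by simp
    \<comment> \<open>The factor \<open>u ^ e i\<close> clears the negative powers of
      \<open>u\<close>; the subtraction of exponents is exact because \<open>e\<^sub>1\<close> is at
      most the total degree.\<close>
    hence "(\<Sum>j'\<in>B. c j' * (1 / u) ^ e\<^sub>1 j') * u ^ e i = 0"
      by simp
    moreover have "c j' * (1 / u) ^ e\<^sub>1 j' * u ^ e i = c j' * u ^ (e i - e\<^sub>1 j')" if "j' \<in> B" for j'
    proof -
      have "e\<^sub>1 j' \<le> e i"
        using that by (auto simp: B_def A_def e_def)
      thus ?thesis
        using u_neq_0 by (simp add: power_diff power_divide)
    qed
    ultimately have "(\<Sum>j'\<in>B. c j' * u ^ (e i - e\<^sub>1 j')) = 0"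
      by (simp add: sum_distrib_right)
    hence "(\<Sum>j'\<in>{j' \<in> B. e i - e\<^sub>1 j' = e i - e\<^sub>1 j}. c j') = 0"
      using c \<open>A \<subseteq> S\<close>
      by (intro rat.transcendental_over_sum_eq_0[OF M.transcendental \<open>finite B\<close>]) (auto simp: B_def)
    moreover have "{j' \<in> B. e i - e\<^sub>1 j' = e i - e\<^sub>1 j} = {j}"
    proof (intro equalityI subsetI)
      fix j' assume "j' \<in> {j' \<in> B. e i - e\<^sub>1 j' = e i - e\<^sub>1 j}"
      hence *: "j' \<in> S" "e j' = e i" "e\<^sub>2 j' = e\<^sub>2 j" "e\<^sub>3 j' = e\<^sub>3 j" "e i - e\<^sub>1 j' = e i - e\<^sub>1 j"
        by (auto simp: B_def A_def)
      have **: "j \<in> S" "e j = e i"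
        using \<open>j \<in> A\<close> by (auto simp: A_def)
      have "e\<^sub>1 j' = e\<^sub>1 j" "e\<^sub>0 j' = e\<^sub>0 j"
        using * ** unfolding e_def by linarith+
      hence "j' = j"
        using * ** by (intro inj) auto
      thus "j' \<in> {j}"
        by simp
    qed (use \<open>j \<in> A\<close> in \<open>auto simp: B_def\<close>)
    ultimately show ?thesis
      by simp
  qed
  show ?thesis
  proof (rule ccontr)
    assume "c i \<noteq> 0"
    define A' where "A' = {j \<in> A. c j \<noteq> 0}"
    have "finite A'" "A' \<noteq> {}"
      using \<open>finite A\<close> \<open>i \<in> A\<close> \<open>c i \<noteq> 0\<close> by (auto simp: A'_def)
    have "Max (e\<^sub>3 ` A') \<in> e\<^sub>3 ` A'"
      using \<open>finite A'\<close> \<open>A' \<noteq> {}\<close> by (intro Max_in) auto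
    then obtain j where j: "j \<in> A'" "e\<^sub>3 j = Max (e\<^sub>3 ` A')"
      by (metis imageE)
    have "c j = 0"
    proof (rule top)
      show "j \<in> A"
        using j by (simp add: A'_def)
      show "e\<^sub>3 j' \<le> e\<^sub>3 j" if "j' \<in> A" "c j' \<noteq> 0" for j'
        unfolding j(2) using \<open>finite A'\<close> that by (intro Max_ge) (auto simp: A'_def)
    qed
    thus False
      using j by (simp add: A'_def)
  qed
qed

lemma algebraically_independent:
  "algebraically_independent_over K [a, mahler a, fls_deriv a, mahler (fls_deriv a)]"
  unfolding algebraically_independent_over_def
proof (intro ballI impI)
  let ?xs = "[a, mahler a, fls_deriv a, mahler (fls_deriv a)]"
  fix P assume P: "P \<in> multipolys_over K (length ?xs)" "multipoly_eval P (\<lambda>i. ?xs ! i) = 0"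
  define S where "S = Poly_Mapping.keys P"
  define ex where "ex i m = Poly_Mapping.lookup m i" for i :: nat and m :: "nat \<Rightarrow>\<^sub>0 nat"
  have keys: "Poly_Mapping.keys m \<subseteq> {..<4}" "Poly_Mapping.lookup P m \<in> K" if "m \<in> S" for m
    using that P(1) by (auto simp: multipolys_over_def S_def eval_nat_numeral)
  have lt4: "{..<4} = {0, 1, 2, 3 :: nat}"
    by auto
  have prod: "(\<Prod>i\<in>Poly_Mapping.keys m. (?xs ! i) ^ Poly_Mapping.lookup m i) =
      a ^ ex 0 m * mahler a ^ ex 1 m * fls_deriv a ^ ex 2 m * mahler (fls_deriv a) ^ ex 3 m"
    if "m \<in> S" for m
  proof -
    have "(\<Prod>i\<in>Poly_Mapping.keys m. (?xs ! i) ^ Poly_Mapping.lookup m i) =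
        (\<Prod>i\<in>{..<4}. (?xs ! i) ^ Poly_Mapping.lookup m i)"
      using keys(1)[OF that] by (intro prod.mono_neutral_left) (auto simp: in_keys_iff)
    also have "\<dots> = a ^ ex 0 m * mahler a ^ ex 1 m * fls_deriv a ^ ex 2 m * mahler (fls_deriv a) ^ ex 3 m"
      unfolding lt4 by (simp add: ex_def mult.assoc numeral_2_eq_2 numeral_3_eq_3)
    finally show ?thesis .
  qed
  have "Poly_Mapping.lookup P m = 0" if "m \<in> S" for m
  proof (rule monomial_relation_trivial[of S "Poly_Mapping.lookup P" "ex 0" "ex 1" "ex 2" "ex 3"])
    show "finite S"
      by (simp add: S_def)
    show "m = m'" if "m \<in> S" "m' \<in> S" "ex 0 m = ex 0 m'" "ex 1 m = ex 1 m'" "ex 2 m = ex 2 m'"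
      "ex 3 m = ex 3 m'" for m m'
    proof (rule poly_mapping_eqI)
      fix i
      show "Poly_Mapping.lookup m i = Poly_Mapping.lookup m' i"
      proof (cases "i < 4")
        case True
        hence "i \<in> {0, 1, 2, 3}"
          by auto
        thus ?thesis
          using that by (auto simp: ex_def)
      next
        case False
        hence "i \<notin> Poly_Mapping.keys m" "i \<notin> Poly_Mapping.keys m'"
          using keys(1) that by auto
        thus ?thesis
          by (simp add: in_keys_iff)
      qed
    qed
    show "(\<Sum>m\<in>S. Poly_Mapping.lookup P m *
        (a ^ ex 0 m * mahler a ^ ex 1 m * fls_deriv a ^ ex 2 m * mahler (fls_deriv a) ^ ex 3 m)) = 0"
      using P(2) unfolding multipoly_eval_def S_def[symmetric] by (simp add: prod cong: sum.cong)
  qed (use keys that in auto)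
  hence "S = {}"
    unfolding S_def by (metis all_not_in_conv in_keys_iff)
  thus "P = 0"
    by (simp add: S_def)
qed

end

section \<open>Transfer from integer power series to complex Laurent series\<close>

lemma complex_fps_of_int_fps_compose_X_power:
  assumes "n > 0"
  shows "complex_fps_of_int_fps (fps_compose F (fps_X ^ n)) =
         fps_compose (complex_fps_of_int_fps F) (fps_X ^ n)"
  using assms by (intro fps_ext) (simp add: complex_fps_of_int_fps_def fps_nth_compose_X_power)

lemma complex_fps_of_int_fps_mult:
  "complex_fps_of_int_fps (F * G) = complex_fps_of_int_fps F * complex_fps_of_int_fps G"
  by (intro fps_ext) (simp add: complex_fps_of_int_fps_def fps_mult_nth)

lemma complex_fps_of_int_fps_diff:
  "complex_fps_of_int_fps (F - G) = complex_fps_of_int_fps F - complex_fps_of_int_fps G"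
  by (intro fps_ext) (simp add: complex_fps_of_int_fps_def)

lemma complex_fps_of_int_fps_X_power: "complex_fps_of_int_fps (fps_X ^ n) = fps_X ^ n"
  by (intro fps_ext) (simp add: complex_fps_of_int_fps_def)

lemma complex_fps_of_int_fps_p:
  "complex_fps_of_int_fps (1 + fps_X + fps_X ^ 2) = 1 + fps_X + fps_X ^ 2"
  by (intro fps_ext) (simp add: complex_fps_of_int_fps_def)

theorem theorem1p1:
  fixes F :: "int fps" and G :: "complex fps"
  assumes F0: "fps_nth F 0 = 1"
    and F_eq: "F = (1 + fps_X + fps_X ^ 2) * fps_compose F (fps_X ^ 4)
                   - fps_X ^ 4 * fps_compose F (fps_X ^ 16)"
  defines "G \<equiv> complex_fps_of_int_fps F"
  shows "algebraically_independent_over complex_rational_functions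
           (map fps_to_fls
             [G, fps_compose G (fps_X ^ 4), fps_deriv G, fps_compose (fps_deriv G) (fps_X ^ 4)])"
proof -
  have G_eq: "G = (1 + fps_X + fps_X ^ 2) * fps_compose G (fps_X ^ 4)
      - fps_X ^ 4 * fps_compose G (fps_X ^ 16)"
    unfolding G_def by (subst F_eq)
      (simp add: complex_fps_of_int_fps_diff complex_fps_of_int_fps_mult complex_fps_of_int_fps_p
        complex_fps_of_int_fps_X_power complex_fps_of_int_fps_compose_X_power)
  have "fps_compose (fps_compose G (fps_X ^ 4)) (fps_X ^ 4) = fps_compose G (fps_X ^ 16)"
    by (intro fps_ext) (auto simp: fps_nth_compose_X_power elim!: dvdE)
  hence mahler_G: "mahler (fps_to_fls G) = fps_to_fls (fps_compose G (fps_X ^ 4))"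
    "mahler (mahler (fps_to_fls G)) = fps_to_fls (fps_compose G (fps_X ^ 16))"
    by (simp_all add: fls_compose_power_fps_to_fls)
  interpret mahler_solution "fps_to_fls G"
  proof
    have "fps_nth G 0 = 1"
      using F0 by (simp add: G_def complex_fps_of_int_fps_def)
    thus "fps_to_fls G \<noteq> 0"
      by auto
    show "fps_to_fls G = mahler_p * mahler (fps_to_fls G) - fls_X ^ 4 * mahler (mahler (fps_to_fls G))"
      unfolding mahler_G(2) unfolding mahler_G(1) mahler_p_def using arg_cong[OF G_eq, of fps_to_fls]
      by (simp add: fls_times_fps_to_fls fps_to_fls_power)
  qed
  have "map fps_to_fls [G, fps_compose G (fps_X ^ 4), fps_deriv G, fps_compose (fps_deriv G) (fps_X ^ 4)] =
      [fps_to_fls G, mahler (fps_to_fls G), fls_deriv (fps_to_fls G), mahler (fls_deriv (fps_to_fls G))]"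
    by (simp add: fls_compose_power_fps_to_fls fls_deriv_fps_to_fls)
  thus ?thesis
    using algebraically_independent by simp
qed

end
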